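(* Let $G$ be an $m$-edge directed multigraph, and let $X,Y\subseteq V(G)$ be disjoint vertex sets with $\mathrm{flow}(G,X,Y)=\lambda$. For every integer $k\ge 0$, there exists an $(X,Y)$-cut $(S,V-S)$ with $|\delta^+(S)|\le \lambda 2^k$ such that every important $(X,Y)$-cut $(S',V-S')$ with $|\delta^+(S')|\le \lambda+k$ satisfies $S'\subseteq S$. Moreover, such a cut $(S,V-S)$ can be computed in time $O(\lambda k2^km+\lambda^2k^24^k)$.
   Context: $V=V(G)$. A cut is a partition $(S,V-S)$; $\delta^+(S)$ is the set of edges leaving $S$ and $\delta^-(S)$ the set of edges entering $S$. An $(X,Y)$-cut is a cut with $X\subseteq S$ and $Y\subseteq V-S$. $\mathrm{flow}(G,X,Y)$ is the maximum number of pairwise edge-disjoint paths from a vertex of $X$ to a vertex of $Y$. An $(X,Y)$-cut $(S,V-S)$ is out-reachable if every $s\in S$ is reachable from some $x\in X$ in $G-\delta^+(S)$. An $(X,Y)$-cut $(S,V-S)$ is important if it is out-reachable and there is no out-reachable $(X,Y)$-cut $(S',V-S')$ with $|\delta^+(S')|\le|\delta^+(S)|$ and $S\subsetneq S'$.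
   Formalization: In the running time, the factors λ and k are read as max(1,λ) and max(1,k), because the stated bound is 0 when λ=0 or k=0 and no algorithm can meet it there; for λ,k≥1 the bound is as stated. *)

theory Defs
  imports "Graph_Theory.Graph_Theory"
begin

section \<open>Cuts and flows in directed multigraphs\<close>

definition out_cut :: "('a, 'b) pre_digraph \<Rightarrow> 'a set \<Rightarrow> 'b set" where
  "out_cut G S = {e \<in> arcs G. tail G e \<in> S \<and> head G e \<in> verts G - S}"

text \<open>A cut \<open>(S, V - S)\<close> is represented by its first side \<open>S\<close>. One of the sides may be empty;
  this can only happen if \<open>X\<close> or \<open>Y\<close> is empty.\<close>

definition is_XY_cut :: "('a, 'b) pre_digraph \<Rightarrow> 'a set \<Rightarrow> 'a set \<Rightarrow> 'a set \<Rightarrow> bool" where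
  "is_XY_cut G X Y S \<longleftrightarrow> S \<subseteq> verts G \<and> X \<subseteq> S \<and> Y \<subseteq> verts G - S"

text \<open>The family of paths is a set of arc lists. For disjoint \<open>X\<close> and \<open>Y\<close> every path from \<open>X\<close>
  to \<open>Y\<close> has an arc, so edge-disjoint paths are different arc lists and the cardinality
  counts them correctly.\<close>

definition edge_disjoint_paths ::
    "('a, 'b) pre_digraph \<Rightarrow> 'a set \<Rightarrow> 'a set \<Rightarrow> 'b list set \<Rightarrow> bool" where
  "edge_disjoint_paths G X Y P \<longleftrightarrow>
     finite P \<and>
     (\<forall>p\<in>P. \<exists>x\<in>X. \<exists>y\<in>Y. pre_digraph.apath G x p y) \<and>
     (\<forall>p\<in>P. \<forall>q\<in>P. p \<noteq> q \<longrightarrow> set p \<inter> set q = {})"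

definition flow :: "('a, 'b) pre_digraph \<Rightarrow> 'a set \<Rightarrow> 'a set \<Rightarrow> nat" where
  "flow G X Y = Max {card P | P. edge_disjoint_paths G X Y P}"

definition delete_arcs :: "('a, 'b) pre_digraph \<Rightarrow> 'b set \<Rightarrow> ('a, 'b) pre_digraph" where
  "delete_arcs G F = G\<lparr>arcs := arcs G - F\<rparr>"

definition out_reachable_cut :: "('a, 'b) pre_digraph \<Rightarrow> 'a set \<Rightarrow> 'a set \<Rightarrow> 'a set \<Rightarrow> bool" where
  "out_reachable_cut G X Y S \<longleftrightarrow>
     is_XY_cut G X Y S \<and>
     (\<forall>s\<in>S. \<exists>x\<in>X. x \<rightarrow>\<^sup>*\<^bsub>delete_arcs G (out_cut G S)\<^esub> s)"

definition important_cut :: "('a, 'b) pre_digraph \<Rightarrow> 'a set \<Rightarrow> 'a set \<Rightarrow> 'a set \<Rightarrow> bool" where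
  "important_cut G X Y S \<longleftrightarrow>
     out_reachable_cut G X Y S \<and>
     \<not> (\<exists>S'. out_reachable_cut G X Y S' \<and> card (out_cut G S') \<le> card (out_cut G S) \<and> S \<subset> S')"

definition covers_important_cuts ::
    "('a, 'b) pre_digraph \<Rightarrow> 'a set \<Rightarrow> 'a set \<Rightarrow> nat \<Rightarrow> 'a set \<Rightarrow> bool" where
  "covers_important_cuts G X Y c S \<longleftrightarrow>
     (\<forall>S'. important_cut G X Y S' \<and> card (out_cut G S') \<le> c \<longrightarrow> S' \<subseteq> S)"


section \<open>A random access machine\<close>

text \<open>
  Running times refer to programs over a store of arrays with random access: \<open>s a i\<close> is
  the content of cell \<open>i\<close> of array \<open>a\<close>, and a scalar variable is an array of which only cell \<open>0\<close>
  is used. Cells hold natural numbers, and the only arithmetic is increment and decrement.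
  One step of a fixed program therefore exceeds the largest number present by at
  most a constant, so the unit cost of a step is not an artefact of arithmetic on long
  integers: after \<open>t\<close> steps all numbers have \<open>O(log (N + t))\<close> bits, where \<open>N\<close> is the largest
  number in the input. Expressions are charged as a part of the command in which they occur;
  for a fixed program this only affects the constant factor.
\<close>

type_synonym store = "nat \<Rightarrow> nat \<Rightarrow> nat"

datatype exp = Const nat | Read nat exp | Inc exp | Dec exp

datatype test = Less exp exp | Equal exp exp | Neg test | Conj test test

datatype prog =
    Nop
  | Write nat exp exp
  | Seq prog prog
  | Cond test prog prog
  | Loop test prog

primrec eval_exp :: "exp \<Rightarrow> store \<Rightarrow> nat" where
  "eval_exp (Const n) s = n"
| "eval_exp (Read a e) s = s a (eval_exp e s)"
| "eval_exp (Inc e) s = eval_exp e s + 1"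
| "eval_exp (Dec e) s = eval_exp e s - 1"

primrec eval_test :: "test \<Rightarrow> store \<Rightarrow> bool" where
  "eval_test (Less e f) s \<longleftrightarrow> eval_exp e s < eval_exp f s"
| "eval_test (Equal e f) s \<longleftrightarrow> eval_exp e s = eval_exp f s"
| "eval_test (Neg b) s \<longleftrightarrow> \<not> eval_test b s"
| "eval_test (Conj b c) s \<longleftrightarrow> eval_test b s \<and> eval_test c s"

text \<open>\<open>exec p s t s'\<close>: started in store \<open>s\<close>, the program \<open>p\<close> halts after \<open>t\<close> steps in store \<open>s'\<close>.\<close>

inductive exec :: "prog \<Rightarrow> store \<Rightarrow> nat \<Rightarrow> store \<Rightarrow> bool" where
  Nop: "exec Nop s 1 s"
| Write: "exec (Write a e f) s 1 (s(a := (s a)(eval_exp e s := eval_exp f s)))"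
| Seq: "exec p s t s' \<Longrightarrow> exec q s' u s'' \<Longrightarrow> exec (Seq p q) s (t + u) s''"
| CondTrue: "eval_test b s \<Longrightarrow> exec p s t s' \<Longrightarrow> exec (Cond b p q) s (t + 1) s'"
| CondFalse: "\<not> eval_test b s \<Longrightarrow> exec q s t s' \<Longrightarrow> exec (Cond b p q) s (t + 1) s'"
| LoopFalse: "\<not> eval_test b s \<Longrightarrow> exec (Loop b p) s 1 s"
| LoopTrue: "eval_test b s \<Longrightarrow> exec p s t s' \<Longrightarrow> exec (Loop b p) s' u s'' \<Longrightarrow>
    exec (Loop b p) s (t + u + 1) s''"

inductive_cases exec_NopE: "exec Nop s t s'"
inductive_cases exec_WriteE: "exec (Write a e f) s t s'"
inductive_cases exec_SeqE: "exec (Seq p q) s t s'"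
inductive_cases exec_CondE: "exec (Cond b p q) s t s'"
inductive_cases exec_LoopE: "exec (Loop b p) s t s'"

lemma exec_deterministic:
  "exec p s t s' \<Longrightarrow> exec p s u s'' \<Longrightarrow> u = t \<and> s'' = s'"
proof (induction arbitrary: u s'' rule: exec.induct)
  case (Seq p s t s1 q u1 s2)
  from Seq.prems obtain t' v u' where "exec p s t' v" "exec q v u' s''" "u = t' + u'"
    by (rule exec_SeqE)
  with Seq.IH(1)[of t' v] Seq.IH(2)[of u' s''] show ?case by simp
next
  case (CondTrue b s p t s1 q)
  from CondTrue.prems obtain t' where "exec p s t' s''" "u = t' + 1"
    by (rule exec_CondE) (simp_all add: CondTrue.hyps)
  with CondTrue.IH[of t' s''] show ?case by simp
next
  case (CondFalse b s q t s1 p)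
  from CondFalse.prems obtain t' where "exec q s t' s''" "u = t' + 1"
    by (rule exec_CondE) (simp_all add: CondFalse.hyps)
  with CondFalse.IH[of t' s''] show ?case by simp
next
  case (LoopFalse b s p)
  from LoopFalse.prems show ?case
    by (rule exec_LoopE) (simp_all add: LoopFalse.hyps)
next
  case (LoopTrue b s p t s1 u1 s2)
  from LoopTrue.prems obtain t' v u'
    where "exec p s t' v" "exec (Loop b p) v u' s''" "u = t' + u' + 1"
    by (rule exec_LoopE) (simp_all add: LoopTrue.hyps)
  with LoopTrue.IH(1)[of t' v] LoopTrue.IH(2)[of u' s''] show ?case by simp
qed (erule exec_NopE exec_WriteE; simp)+


section \<open>Encoding of instances\<close>

definition numbered :: "(nat, nat) pre_digraph \<Rightarrow> bool" where
  "numbered G \<longleftrightarrow> verts G = {..<card (verts G)} \<and> arcs G = {..<card (arcs G)}"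

text \<open>
  Array \<open>0\<close> holds the numbers of vertices and of arcs and the parameter \<open>k\<close>, arrays \<open>1\<close> and \<open>2\<close>
  are the unsorted list of arcs, arrays \<open>3\<close> and \<open>4\<close> are the characteristic functions of \<open>X\<close> and
  \<open>Y\<close>. Everything else is zero. In particular the value of the flow is not part of the input.
\<close>

definition input_store ::
    "(nat, nat) pre_digraph \<Rightarrow> nat set \<Rightarrow> nat set \<Rightarrow> nat \<Rightarrow> store" where
  "input_store G X Y k = (\<lambda>a i.
     if a = 0 then
       (if i = 0 then card (verts G) else if i = 1 then card (arcs G) else if i = 2 then k else 0)
     else if a = 1 then (if i \<in> arcs G then tail G i else 0)
     else if a = 2 then (if i \<in> arcs G then head G i else 0)
     else if a = 3 then (if i \<in> X then 1 else 0)
     else if a = 4 then (if i \<in> Y then 1 else 0)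
     else 0)"

text \<open>
  The result replaces \<open>X\<close> in place. The time bound does not mention the number of vertices,
  so there may be no time to copy the members of \<open>X\<close> that are isolated vertices.
\<close>

definition output_set :: "(nat, nat) pre_digraph \<Rightarrow> store \<Rightarrow> nat set" where
  "output_set G s = {v \<in> verts G. s 3 v \<noteq> 0}"

text \<open>
  The function \<open>\<lambda> k 2\<^sup>k m + \<lambda>\<^sup>2 k\<^sup>2 4\<^sup>k\<close> inside the O-notation vanishes for \<open>\<lambda> = 0\<close> and for \<open>k = 0\<close>,
  where no program can meet it. As usual, \<open>\<lambda>\<close> and \<open>k\<close> are read as \<open>max 1 \<lambda>\<close> and \<open>max 1 k\<close> when they
  occur as factors; this changes nothing for \<open>\<lambda> \<ge> 1\<close> and \<open>k \<ge> 1\<close>.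
\<close>

definition time_bound :: "nat \<Rightarrow> nat \<Rightarrow> nat \<Rightarrow> nat" where
  "time_bound l k m =
     max 1 l * max 1 k * 2 ^ k * m + (max 1 l)\<^sup>2 * (max 1 k)\<^sup>2 * 4 ^ k"

end

theory Submission
  imports Defs "HOL-Library.Multiset"
begin

text \<open>
  Let \<open>c(S)\<close> be the number of arcs leaving \<open>S\<close>. For a multiset \<open>M\<close> of vertices the function
  \<open>r(S) = c(S) - |M \<inter> S|\<close> on the sets \<open>S\<close> disjoint from \<open>Y\<close> is submodular, so if it is
  nonnegative, there is a greatest set \<open>T\<close> with \<open>r(T) = 0\<close>. A vertex \<open>v\<close> outside \<open>T\<close> can be added to \<open>M\<close>
  (pushed) without making \<open>r\<close> negative, and \<open>T\<close> grows. Pushing vertices of \<open>X\<close> until \<open>X \<subseteq> T\<close> takes exactly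
  \<open>\<lambda>\<close> pushes. Then follow \<open>k\<close> phases: for every arc leaving the set \<open>T\<close> of the beginning of the phase,
  the head of the arc is pushed unless it has already been swallowed by \<open>T\<close>. Since \<open>c(T) = |M \<inter> T| \<le> |M|\<close>,
  a phase at most doubles \<open>|M|\<close>, and \<open>c(T) \<le> |M| \<le> \<lambda> 2\<^sup>k\<close> at the end. For an out-reachable cut \<open>S\<close> that is
  not contained in \<open>T\<close>, some arc leaving \<open>T\<close> has its head in \<open>S\<close>, and uncrossing shows that every phase
  decreases \<open>r(S \<union> T)\<close>, which is at most \<open>k\<close> after the first \<open>\<lambda>\<close> pushes; so \<open>S \<subseteq> T\<close> after \<open>k\<close> phases.

  The program represents \<open>M\<close> by an orientation of the arcs in which \<open>r(S)\<close> is the number of arcs leaving \<open>S\<close>.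
  Pushing \<open>v\<close> means to reverse a path from \<open>v\<close> to \<open>Y\<close>, and \<open>T\<close> consists of the vertices that cannot reach \<open>Y\<close>.
  Hence a push costs one graph search, and there are at most \<open>\<lambda> 2\<^sup>k\<close> of them.
\<close>

section \<open>Submodularity and reversal of arcs\<close>

text \<open>The tail and head maps are parameters because one arc set is measured in many
  orientations.\<close>

definition cut_size :: "'e set \<Rightarrow> ('e \<Rightarrow> 'v) \<Rightarrow> ('e \<Rightarrow> 'v) \<Rightarrow> 'v set \<Rightarrow> nat" where
  "cut_size A t h S = card {e \<in> A. t e \<in> S \<and> h e \<notin> S}"

definition hits :: "'v multiset \<Rightarrow> 'v set \<Rightarrow> nat" where
  "hits M S = size {#v \<in># M. v \<in> S#}"

lemma cut_size_eq_sum: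
  assumes "finite A"
  shows "int (cut_size A t h S) = (\<Sum>e\<in>A. of_bool (t e \<in> S \<and> h e \<notin> S))"
  using assms by (simp add: cut_size_def Collect_conj_eq Int_commute of_bool_def sum.If_cases)

text \<open>Checked arc by arc: an arc leaving the union or the intersection leaves \<open>S\<close>
  or \<open>T\<close>, and an arc leaving both of the former leaves both of the latter.\<close>

lemma cut_size_submodular:
  assumes "finite A"
  shows "int (cut_size A t h (S \<union> T)) + int (cut_size A t h (S \<inter> T))
       \<le> int (cut_size A t h S) + int (cut_size A t h T)"
  unfolding cut_size_eq_sum[OF assms] sum.distrib[symmetric]
  by (rule sum_mono) auto

lemma hits_empty [simp]: "hits {#} S = 0"
  by (simp add: hits_def)

lemma hits_add [simp]: "hits (add_mset v M) S = hits M S + of_bool (v \<in> S)"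
  by (simp add: hits_def)

lemma hits_modular: "hits M (S \<union> T) + hits M (S \<inter> T) = hits M S + hits M T"
  by (induction M) auto

lemma hits_le_size: "hits M S \<le> size M"
  by (simp add: hits_def size_filter_mset_lesseq)

lemma hits_eq_size: "set_mset M \<subseteq> S \<Longrightarrow> hits M S = size M"
  by (induction M) auto

lemma hits_singleton: "hits M {x} = count M x"
  by (induction M) auto

text \<open>Reversal matters only for an arc with ends on different sides of \<open>S\<close>: it
  turns from leaving to entering or back, which the difference of the indicators measures with the
  right sign.\<close>

lemma cut_size_reverse:
  assumes "finite A" "P \<subseteq> A"
  shows "int (cut_size A (\<lambda>e. if e \<in> P then h e else t e) (\<lambda>e. if e \<in> P then t e else h e) S)
       = int (cut_size A t h S) + (\<Sum>e\<in>P. of_bool (h e \<in> S) - of_bool (t e \<in> S))"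
proof -
  have *: "(\<Sum>e\<in>P. of_bool (h e \<in> S) - of_bool (t e \<in> S))
     = (\<Sum>e\<in>A. if e \<in> P then of_bool (h e \<in> S) - of_bool (t e \<in> S) else (0::int))"
    using assms by (intro sum.mono_neutral_cong_left) auto
  show ?thesis
    unfolding cut_size_eq_sum[OF assms(1)] * sum.distrib[symmetric]
    by (rule sum.cong) auto
qed

text \<open>Telescoping; with an indicator as \<open>f\<close> it yields the net number of times a
  walk enters a set.\<close>

lemma (in pre_digraph) sum_list_along_cas:
  "cas u p w \<Longrightarrow> (\<Sum>e\<leftarrow>p. f (head G e) - f (tail G e)) = (f w - f u :: int)"
  by (induction u p w rule: cas.induct) auto

lemma (in wf_digraph) apath_distinct_arcs: "apath u p v \<Longrightarrow> distinct p"
  by (induction p arbitrary: u) (auto simp: apath_Cons_iff apath_def awalk_def awalk_verts_conv distinct_map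
      split: if_splits)

lemma (in wf_digraph) sum_along_apath:
  assumes "apath u p w"
  shows "(\<Sum>e\<in>set p. f (head G e) - f (tail G e)) = (f w - f u :: int)"
  using assms sum_list_along_cas[of u p w f] apath_distinct_arcs[OF assms]
  by (auto simp: sum_list_distinct_conv_sum_set apath_def awalk_def)

section \<open>Finite digraphs with disjoint terminal sets\<close>

locale terminal_digraph = fin_digraph G for G :: "('a, 'b) pre_digraph" +
  fixes X Y :: "'a set"
  assumes X_verts: "X \<subseteq> verts G" and Y_verts: "Y \<subseteq> verts G" and XY_disjoint: "X \<inter> Y = {}"
begin

lemma card_out_cut: "card (out_cut G S) = cut_size (arcs G) (tail G) (head G) S"
  by (auto simp: out_cut_def cut_size_def intro!: arg_cong[of _ _ card])

section \<open>Menger's theorem\<close>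

lemma awalk_leaves_cut:
  assumes "awalk u p v" "u \<in> S" "v \<notin> S"
  shows "\<exists>e\<in>set p. e \<in> out_cut G S"
  using assms
proof (induction p arbitrary: u)
  case (Cons e p)
  then show ?case
    by (cases "head G e \<in> S") (auto simp: awalk_Cons_iff out_cut_def)
qed (simp add: awalk_Nil_iff)

text \<open>Weak duality: every path uses an arc of the cut, and choosing one per path is injective
  by edge-disjointness.\<close>

lemma edge_disjoint_paths_le_cut:
  assumes P: "edge_disjoint_paths G X Y P" and S: "is_XY_cut G X Y S"
  shows "card P \<le> card (out_cut G S)"
proof -
  have "\<forall>p\<in>P. \<exists>e\<in>set p. e \<in> out_cut G S"
    using P S unfolding edge_disjoint_paths_def is_XY_cut_def apath_def
    by (blast intro: awalk_leaves_cut)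
  then obtain f where f: "\<And>p. p \<in> P \<Longrightarrow> f p \<in> set p \<and> f p \<in> out_cut G S"
    by metis
  have "inj_on f P"
    using P f unfolding inj_on_def edge_disjoint_paths_def by (metis disjoint_iff)
  moreover have "f ` P \<subseteq> out_cut G S" "finite (out_cut G S)"
    using f by (auto simp: out_cut_def)
  ultimately show ?thesis by (rule card_inj_on_le)
qed

lemma X_is_cut: "is_XY_cut G X Y X"
  using X_verts Y_verts XY_disjoint by (auto simp: is_XY_cut_def)

text \<open>Makes the \<open>Max\<close> in \<open>flow\<close> meaningful; the cut \<open>X\<close>
  bounds the sizes.\<close>

lemma finite_path_family_sizes: "finite {card P | P. edge_disjoint_paths G X Y P}"
  by (rule finite_subset[of _ "{..card (out_cut G X)}"])
    (auto intro: edge_disjoint_paths_le_cut X_is_cut)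

lemma flow_ge: "edge_disjoint_paths G X Y P \<Longrightarrow> card P \<le> flow G X Y"
  unfolding flow_def using finite_path_family_sizes by (intro Max_ge) auto

lemma flow_le_cut:
  assumes "is_XY_cut G X Y S"
  shows "flow G X Y \<le> card (out_cut G S)"
proof -
  have "edge_disjoint_paths G X Y {}" by (simp add: edge_disjoint_paths_def)
  then have "flow G X Y \<in> {card P | P. edge_disjoint_paths G X Y P}"
    unfolding flow_def by (intro Max_in finite_path_family_sizes) auto
  with assms edge_disjoint_paths_le_cut show ?thesis by auto
qed

text \<open>A set of arcs is viewed as a unit flow; this is its net value out of a vertex set.\<close>

definition net :: "'b set \<Rightarrow> 'a set \<Rightarrow> int" where
  "net F S = (\<Sum>e\<in>F. of_bool (tail G e \<in> S) - of_bool (head G e \<in> S))"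

text \<open>Conservation is stated for whole sets avoiding \<open>Y\<close>: the net outflow of
  \<open>S\<close> is the number of sources in it, where \<open>M\<close> lists the sources with
  multiplicity.\<close>

definition unit_flow :: "'b set \<Rightarrow> 'a multiset \<Rightarrow> bool" where
  "unit_flow F M \<longleftrightarrow> F \<subseteq> arcs G \<and> set_mset M \<subseteq> X \<and>
     (\<forall>S. S \<subseteq> verts G - Y \<longrightarrow> net F S = int (hits M S))"

text \<open>Induction on the sources: a path from \<open>x\<close> to \<open>Y\<close> inside
  \<open>F\<close> is split off, and the remaining arcs form a unit flow for the remaining
  sources.\<close>

lemma unit_flow_decomposition:
  "unit_flow F M \<Longrightarrow>
     \<exists>P. edge_disjoint_paths G X Y P \<and> card P = size M \<and> (\<forall>p\<in>P. set p \<subseteq> F)"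
proof (induction M arbitrary: F)
  case empty
  then show ?case by (intro exI[of _ "{}"]) (simp add: edge_disjoint_paths_def)
next
  case (add x M)
  have FA: "F \<subseteq> arcs G" and xX: "x \<in> X" and MX: "set_mset M \<subseteq> X"
    and net: "\<And>S. S \<subseteq> verts G - Y \<Longrightarrow> net F S = int (hits (add_mset x M) S)"
    using add.prems by (auto simp: unit_flow_def)
  define H where "H = G\<lparr>arcs := F\<rparr>"
  have H: "verts H = verts G" "arcs H = F" "tail H = tail G" "head H = head G"
    by (simp_all add: H_def)
  interpret H: wf_digraph H
    using FA by unfold_locales (auto simp: H)
  have sub: "subgraph H G"
    using FA H.wf_digraph wf_digraph by (simp add: subgraph_def H compatible_def)
  define R where "R = {v. x \<rightarrow>\<^sup>*\<^bsub>H\<^esub> v}"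
  have RV: "R \<subseteq> verts G"
    by (auto simp: R_def H dest: H.reachable_in_verts)
  have xR: "x \<in> R"
    using xX X_verts by (auto simp: R_def H)
  have closed: "head G e \<in> R" if "e \<in> F" "tail G e \<in> R" for e
  proof -
    have "tail G e \<rightarrow>\<^bsub>H\<^esub> head G e"
      using that by (auto simp: arcs_ends_def arc_to_ends_def H)
    then show ?thesis
      using that H.reachable_adj_trans by (auto simp: R_def)
  qed
  \<comment> \<open>No arc of \<open>F\<close> leaves \<open>R\<close>, so its net value is at most
    0; if \<open>R\<close> missed \<open>Y\<close>, the source \<open>x\<close> in \<open>R\<close>
    would force at least 1.\<close>
  have "R \<inter> Y \<noteq> {}"
  proof
    assume "R \<inter> Y = {}"
    then have "net F R = int (hits (add_mset x M) R)"
      using RV by (intro net) auto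
    then have "net F R \<ge> 1" using xR by simp
    moreover have "net F R \<le> 0"
      unfolding net_def by (rule sum_nonpos) (auto dest: closed)
    ultimately show False by simp
  qed
  then obtain y where y: "y \<in> Y" "x \<rightarrow>\<^sup>*\<^bsub>H\<^esub> y" by (auto simp: R_def)
  then obtain p where p: "H.apath x p y" using H.reachable_apath by auto
  then have pF: "set p \<subseteq> F" by (auto simp: H.apath_def H.awalk_def H)
  have pG: "apath x p y" using subgraph_apath_imp_apath[OF p sub] .
  have "x \<noteq> y" using xX y XY_disjoint by auto
  then have "p \<noteq> []" using pG by (auto simp: apath_Nil_iff)
  have "unit_flow (F - set p) M"
    unfolding unit_flow_def
  proof (intro conjI allI impI)
    fix S assume S: "S \<subseteq> verts G - Y"
    have "finite F" using FA by (rule finite_subset) simp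
    have "net F S = net (F - set p) S + net (set p) S"
      unfolding net_def by (rule sum.subset_diff[OF pF \<open>finite F\<close>])
    moreover have "net (set p) S = of_bool (x \<in> S) - of_bool (y \<in> S)"
      using sum_along_apath[OF pG, of "\<lambda>v. of_bool (v \<in> S)"]
      by (simp add: net_def sum_subtractf)
    ultimately show "net (F - set p) S = int (hits M S)"
      using net[OF S] S y by auto
  qed (use FA MX in auto)
  from add.IH[OF this] obtain P where
    P: "edge_disjoint_paths G X Y P" "card P = size M" "\<forall>q\<in>P. set q \<subseteq> F - set p" by blast
  \<comment> \<open>The members of \<open>P\<close> avoid the arcs of the nonempty \<open>p\<close>,
    so inserting \<open>p\<close> really raises the cardinality.\<close>
  have "p \<notin> P" using P(3) \<open>p \<noteq> []\<close> by (cases p) auto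
  moreover have "finite P" using P by (simp add: edge_disjoint_paths_def)
  moreover have "edge_disjoint_paths G X Y (insert p P)"
    unfolding edge_disjoint_paths_def
  proof (intro conjI ballI impI)
    fix q q' assume "q \<in> insert p P" "q' \<in> insert p P" "q \<noteq> q'"
    then show "set q \<inter> set q' = {}"
      using P unfolding edge_disjoint_paths_def by blast
  qed (use P pG xX y in \<open>auto simp: edge_disjoint_paths_def\<close>)
  ultimately show ?case
    using P pF by (intro exI[of _ "insert p P"]) auto
qed

lemma size_le_flow: "unit_flow F M \<Longrightarrow> size M \<le> flow G X Y"
  using unit_flow_decomposition flow_ge by metis

text \<open>\<open>H\<close> is the residual graph: arcs of \<open>F\<close> can be used only
  backwards, the others only forwards. The new flow is the symmetric difference of \<open>F\<close>
  with an augmenting path.\<close>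

lemma unit_flow_augment:
  assumes FM: "unit_flow F M" and x: "x \<in> X" and y: "y \<in> Y"
    and H: "H = G\<lparr>tail := \<lambda>e. if e \<in> F then head G e else tail G e,
                 head := \<lambda>e. if e \<in> F then tail G e else head G e\<rparr>"
    and xy: "x \<rightarrow>\<^sup>*\<^bsub>H\<^esub> y"
  shows "\<exists>F'. unit_flow F' (add_mset x M)"
proof -
  have FA: "F \<subseteq> arcs G" using FM by (simp add: unit_flow_def)
  interpret H: wf_digraph H
    by unfold_locales (auto simp: H)
  obtain p where p: "H.apath x p y" using xy H.reachable_apath by auto
  have "arcs H = arcs G" by (simp add: H)
  then have pA: "set p \<subseteq> arcs G" using p by (simp add: H.apath_def H.awalk_def)
  define F' where "F' = (F - set p) \<union> (set p - F)"
  have "net F' S = int (hits (add_mset x M) S)" if S: "S \<subseteq> verts G - Y" for S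
  proof -
    have "(\<Sum>e\<in>set p. of_bool (head H e \<in> S) - of_bool (tail H e \<in> S))
        = (of_bool (y \<in> S) - of_bool (x \<in> S) :: int)"
      using H.sum_along_apath[OF p, of "\<lambda>v. of_bool (v \<in> S)"] .
    \<comment> \<open>Dropping an arc of \<open>F\<close> and adding an arc outside \<open>F\<close>
      have opposite signs, but the ends of the former are swapped in \<open>H\<close>; so both kinds
      merge into one telescoping sum along \<open>p\<close>.\<close>
    moreover have "net F' S = net F S
        - (\<Sum>e\<in>set p. of_bool (head H e \<in> S) - of_bool (tail H e \<in> S))"
    proof -
      have "net F S = net (F - set p) S + net (F \<inter> set p) S"
        unfolding net_def using FA
        by (subst sum.union_disjoint[symmetric]) (auto intro!: sum.cong dest: finite_subset)
      moreover have "net F' S = net (F - set p) S + net (set p - F) S"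
        unfolding net_def F'_def using FA
        by (intro sum.union_disjoint) (auto dest: finite_subset)
      moreover have "(\<Sum>e\<in>set p. of_bool (head H e \<in> S) - of_bool (tail H e \<in> S))
          = net (F \<inter> set p) S - net (set p - F) S"
      proof -
        have "(\<Sum>e\<in>set p. of_bool (head H e \<in> S) - of_bool (tail H e \<in> S)) =
            (\<Sum>e\<in>F \<inter> set p. of_bool (head H e \<in> S) - of_bool (tail H e \<in> S)) +
            (\<Sum>e\<in>set p - F. of_bool (head H e \<in> S) - of_bool (tail H e \<in> S) :: int)"
          by (subst sum.union_disjoint[symmetric]) (auto intro!: sum.cong)
        also have "(\<Sum>e\<in>F \<inter> set p. of_bool (head H e \<in> S) - of_bool (tail H e \<in> S)) = net (F \<inter> set p) S"
          unfolding net_def by (rule sum.cong) (auto simp: H)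
        also have "(\<Sum>e\<in>set p - F. of_bool (head H e \<in> S) - of_bool (tail H e \<in> S)) = - net (set p - F) S"
          unfolding net_def sum_negf[symmetric] by (rule sum.cong) (auto simp: H)
        finally show ?thesis by simp
      qed
      ultimately show ?thesis by simp
    qed
    ultimately show ?thesis
      using FM S y by (auto simp: unit_flow_def)
  qed
  then have "unit_flow F' (add_mset x M)"
    using FM pA x by (auto simp: unit_flow_def F'_def)
  then show ?thesis ..
qed

text \<open>For a unit flow with the most sources, the set \<open>R\<close> reachable from
  \<open>X\<close> in the residual graph misses \<open>Y\<close> and is a cut of the same size; weak
  duality then identifies both numbers with \<open>flow\<close>.\<close>

lemma max_flow_min_cut:
  obtains F M R where "unit_flow F M" "is_XY_cut G X Y R"
    "card (out_cut G R) = size M" "size M = flow G X Y"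
proof -
  have "unit_flow {} {#}" by (simp add: unit_flow_def net_def)
  then obtain M where M: "\<exists>F. unit_flow F M"
    and max: "\<And>M'. \<exists>F'. unit_flow F' M' \<Longrightarrow> size M' \<le> size M"
    using ex_has_greatest_nat[of "\<lambda>M. \<exists>F. unit_flow F M" "{#}" size "flow G X Y + 1"]
      size_le_flow by (auto simp: less_Suc_eq_le)
  from M obtain F where FM: "unit_flow F M" ..
  then have FA: "F \<subseteq> arcs G" by (simp add: unit_flow_def)
  define H where "H = G\<lparr>tail := \<lambda>e. if e \<in> F then head G e else tail G e,
                       head := \<lambda>e. if e \<in> F then tail G e else head G e\<rparr>"
  interpret H: wf_digraph H
    by unfold_locales (auto simp: H_def)
  define R where "R = {v. \<exists>x\<in>X. x \<rightarrow>\<^sup>*\<^bsub>H\<^esub> v}"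
  have "R \<inter> Y = {}"
  proof (rule ccontr)
    assume "R \<inter> Y \<noteq> {}"
    then obtain x y where "x \<in> X" "y \<in> Y" "x \<rightarrow>\<^sup>*\<^bsub>H\<^esub> y" by (auto simp: R_def)
    then have "size (add_mset x M) \<le> size M"
      using unit_flow_augment[OF FM _ _ H_def] by (intro max) blast
    then show False by simp
  qed
  moreover have VH: "verts H = verts G" by (simp add: H_def)
  then have "R \<subseteq> verts G"
    using H.reachable_in_verts by (auto simp: R_def)
  moreover have XR: "X \<subseteq> R"
  proof
    fix x assume "x \<in> X"
    then have "x \<rightarrow>\<^sup>*\<^bsub>H\<^esub> x" using X_verts VH by (intro H.reachable_refl) auto
    then show "x \<in> R" using \<open>x \<in> X\<close> by (auto simp: R_def)
  qed
  ultimately have R: "is_XY_cut G X Y R" and RY: "R \<subseteq> verts G - Y"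
    using Y_verts by (auto simp: is_XY_cut_def)
  have closed: "head H e \<in> R" if "e \<in> arcs G" "tail H e \<in> R" for e
  proof -
    have "tail H e \<rightarrow>\<^bsub>H\<^esub> head H e"
      using that by (auto simp: arcs_ends_def arc_to_ends_def H_def)
    then show ?thesis
      using that H.reachable_adj_trans by (auto simp: R_def)
  qed
  \<comment> \<open>Nothing leaves \<open>R\<close> in the residual graph, and reversing
    \<open>F\<close> lowers the number of leaving arcs by the net value, which is
    \<open>size M\<close> because \<open>R\<close> contains all sources.\<close>
  have "cut_size (arcs G) (tail H) (head H) R = 0"
    using closed by (auto simp: cut_size_def)
  moreover have "int (cut_size (arcs G) (tail H) (head H) R)
      = int (card (out_cut G R)) - net F R"
    using cut_size_reverse[OF finite_arcs FA, of "head G" "tail G" R]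
    by (simp add: H_def card_out_cut net_def sum_subtractf)
  moreover have "net F R = int (size M)"
    using FM RY XR hits_eq_size[of M R] by (auto simp: unit_flow_def)
  ultimately have "card (out_cut G R) = size M" by simp
  moreover from this have "size M = flow G X Y"
    using size_le_flow[OF FM] flow_le_cut[OF R] by simp
  ultimately show ?thesis using that FM R by blast
qed

section \<open>Greatest tight sets\<close>

definition residual :: "'a multiset \<Rightarrow> 'a set \<Rightarrow> int" where
  "residual M S = int (card (out_cut G S)) - int (hits M S)"

text \<open>Only maximality of \<open>T\<close> is demanded; together with nonnegativity of the
  residual it implies that \<open>T\<close> contains every tight set.\<close>

definition greatest_tight :: "'a multiset \<Rightarrow> 'a set \<Rightarrow> bool" where
  "greatest_tight M T \<longleftrightarrow> T \<subseteq> verts G - Y \<and> residual M T = 0 \<and>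
     (\<forall>S. S \<subseteq> verts G - Y \<longrightarrow> 0 \<le> residual M S) \<and>
     (\<forall>S. S \<subseteq> verts G - Y \<longrightarrow> T \<subset> S \<longrightarrow> 0 < residual M S)"

lemma residual_submodular:
  "residual M (S \<union> T) + residual M (S \<inter> T) \<le> residual M S + residual M T"
  using cut_size_submodular[OF finite_arcs, of "tail G" "head G" S T] hits_modular[of M S T]
  by (simp add: residual_def card_out_cut)

lemma residual_add: "residual (add_mset v M) S = residual M S - of_bool (v \<in> S)"
  by (simp add: residual_def)

text \<open>Uncrossing: otherwise the union with \<open>T\<close> would have positive and the
  intersection nonnegative residual, although the residuals of \<open>S\<close> and \<open>T\<close>
  sum to at most 0.\<close>

lemma tight_subset_greatest:
  assumes T: "greatest_tight M T" and S: "S \<subseteq> verts G - Y" "residual M S \<le> 0"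
  shows "S \<subseteq> T"
proof (rule ccontr)
  assume "\<not> S \<subseteq> T"
  then have "T \<subset> S \<union> T" by blast
  moreover have "S \<union> T \<subseteq> verts G - Y" "S \<inter> T \<subseteq> verts G - Y"
    using T S unfolding greatest_tight_def by blast+
  ultimately have "0 < residual M (S \<union> T)" "0 \<le> residual M (S \<inter> T)" "residual M T = 0"
    using T unfolding greatest_tight_def by blast+
  then show False using residual_submodular[of M S T] S by linarith
qed

text \<open>The empty set is tight, so a tight set of maximum cardinality exists.\<close>

lemma greatest_tight_exists:
  assumes "\<And>S. S \<subseteq> verts G - Y \<Longrightarrow> 0 \<le> residual M S"
  shows "\<exists>T. greatest_tight M T"
proof -
  let ?P = "\<lambda>T. T \<subseteq> verts G - Y \<and> residual M T = 0"
  have "?P {}" by (simp add: residual_def out_cut_def hits_def)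
  moreover have "\<forall>T. ?P T \<longrightarrow> card T < card (verts G) + 1"
  proof (intro allI impI)
    fix T assume "?P T"
    then have "T \<subseteq> verts G" by blast
    then show "card T < card (verts G) + 1" using card_mono[of "verts G" T] by simp
  qed
  ultimately have "\<exists>T. ?P T \<and> (\<forall>T'. ?P T' \<longrightarrow> card T' \<le> card T)"
    by (rule ex_has_greatest_nat)
  then obtain T where T: "?P T" and max: "\<And>T'. ?P T' \<Longrightarrow> card T' \<le> card T"
    by blast
  have "0 < residual M S" if S: "S \<subseteq> verts G - Y" and TS: "T \<subset> S" for S
  proof -
    have "finite S" using S by (auto intro: finite_subset[OF _ finite_verts])
    then have "card T < card S" using TS by (rule psubset_card_mono)
    then have "residual M S \<noteq> 0" using max[of S] S by auto
    then show ?thesis using assms[OF S] by simp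
  qed
  then show ?thesis using T assms by (auto simp: greatest_tight_def)
qed

text \<open>A set containing a vertex outside \<open>T\<close> is not tight, so its integral
  residual can afford the loss of 1.\<close>

lemma push_residual_nonneg:
  assumes T: "greatest_tight M T" and v: "v \<notin> T" and S: "S \<subseteq> verts G - Y"
  shows "0 \<le> residual (add_mset v M) S"
proof (cases "v \<in> S")
  case True
  then have "0 < residual M S"
    using tight_subset_greatest[OF T S] v by force
  then show ?thesis by (simp add: residual_add)
qed (use T S in \<open>simp add: greatest_tight_def residual_add\<close>)

lemma push_mono:
  assumes T: "greatest_tight M T" and v: "v \<notin> T" and T': "greatest_tight (add_mset v M) T'"
  shows "T \<subseteq> T'"
  using tight_subset_greatest[OF T', of T] T v by (simp add: greatest_tight_def residual_add)

text \<open>\<open>S \<union> T\<close> is uncrossed with \<open>T'\<close> under the new residual.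
  The drop is strict if \<open>v\<close> lies in \<open>S\<close>, because of the pushed unit, or if
  the intersection properly extends \<open>T\<close> without containing \<open>v\<close>, because
  its residual was already positive.\<close>

lemma push_slack:
  assumes T: "greatest_tight M T" and v: "v \<notin> T" and T': "greatest_tight (add_mset v M) T'"
    and S: "S \<subseteq> verts G - Y"
  shows "residual (add_mset v M) (S \<union> T') \<le> residual M (S \<union> T)"
    and "v \<in> S \<or> \<not> S \<inter> T' \<subseteq> T \<Longrightarrow> residual (add_mset v M) (S \<union> T') < residual M (S \<union> T)"
proof -
  let ?M = "add_mset v M"
  have TT: "T \<subseteq> T'" using push_mono[OF T v T'] .
  then have un: "(S \<union> T) \<union> T' = S \<union> T'" by auto
  have sub: "(S \<union> T) \<inter> T' \<subseteq> verts G - Y" using T' by (auto simp: greatest_tight_def)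
  have main: "residual ?M (S \<union> T') + residual ?M ((S \<union> T) \<inter> T') \<le> residual M (S \<union> T) - of_bool (v \<in> S)"
    using residual_submodular[of ?M "S \<union> T" T'] T' v residual_add[of v M "S \<union> T"]
    unfolding un by (simp add: greatest_tight_def)
  have nonneg: "0 \<le> residual ?M ((S \<union> T) \<inter> T')" using T' sub unfolding greatest_tight_def by blast
  show "residual ?M (S \<union> T') \<le> residual M (S \<union> T)"
    using main nonneg by (cases "v \<in> S") simp_all
  assume "v \<in> S \<or> \<not> S \<inter> T' \<subseteq> T"
  then show "residual ?M (S \<union> T') < residual M (S \<union> T)"
  proof (cases "v \<in> S")
    case True
    then show ?thesis using main nonneg by simp
  next
    case False
    then have "T \<subset> (S \<union> T) \<inter> T'" using \<open>v \<in> S \<or> \<not> S \<inter> T' \<subseteq> T\<close> TT by auto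
    then have "0 < residual M ((S \<union> T) \<inter> T')"
      using T sub by (simp add: greatest_tight_def)
    then have "0 < residual ?M ((S \<union> T) \<inter> T')" using False v by (simp add: residual_add)
    then show ?thesis using main False by simp
  qed
qed

section \<open>Phases\<close>

text \<open>\<open>phase M\<^sub>0 T\<^sub>0 D M T\<close>: a phase started with \<open>M\<^sub>0\<close> and \<open>T\<^sub>0\<close> has processed the arcs in \<open>D\<close> and
  arrived at \<open>M\<close> and \<open>T\<close>. An arc leaving \<open>T\<^sub>0\<close> whose head is still outside \<open>T\<close> pushes its head.\<close>

definition phase ::
    "'a multiset \<Rightarrow> 'a set \<Rightarrow> 'b set \<Rightarrow> 'a multiset \<Rightarrow> 'a set \<Rightarrow> bool" where
  "phase M\<^sub>0 T\<^sub>0 D M T \<longleftrightarrow> greatest_tight M T \<and> T\<^sub>0 \<subseteq> T \<and>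
     size M \<le> size M\<^sub>0 + card (D \<inter> out_cut G T\<^sub>0) \<and>
     (\<forall>S. S \<subseteq> verts G - Y \<longrightarrow>
        residual M (S \<union> T) \<le> residual M\<^sub>0 (S \<union> T\<^sub>0) \<and>
        (\<not> S \<inter> T \<subseteq> T\<^sub>0 \<or> (\<exists>e\<in>D \<inter> out_cut G T\<^sub>0. head G e \<in> S) \<longrightarrow>
           residual M (S \<union> T) < residual M\<^sub>0 (S \<union> T\<^sub>0)))"

lemma phase_start: "greatest_tight M T \<Longrightarrow> phase M T {} M T"
  by (auto simp: phase_def)

lemma finite_out_cut [simp]: "finite (out_cut G S)"
  by (simp add: out_cut_def)

text \<open>If a skipped arc leaves \<open>T\<^sub>0\<close> and its head is in \<open>S\<close>,
  the head was swallowed by \<open>T\<close>. Then \<open>S\<close> meets \<open>T\<close> outside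
  \<open>T\<^sub>0\<close>, and the residual has already dropped.\<close>

lemma phase_skip:
  assumes ph: "phase M\<^sub>0 T\<^sub>0 D M T" and e: "tail G e \<notin> T\<^sub>0 \<or> head G e \<in> T"
  shows "phase M\<^sub>0 T\<^sub>0 (insert e D) M T"
proof -
  have "card (D \<inter> out_cut G T\<^sub>0) \<le> card (insert e D \<inter> out_cut G T\<^sub>0)"
    by (rule card_mono) auto
  then have "size M \<le> size M\<^sub>0 + card (insert e D \<inter> out_cut G T\<^sub>0)"
    using ph by (simp add: phase_def)
  moreover have *: "\<not> S \<inter> T \<subseteq> T\<^sub>0"
    if "e \<in> out_cut G T\<^sub>0" "head G e \<in> S" for S
    using that e by (auto simp: out_cut_def)
  have "residual M (S \<union> T) < residual M\<^sub>0 (S \<union> T\<^sub>0)"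
    if "S \<subseteq> verts G - Y" "\<not> S \<inter> T \<subseteq> T\<^sub>0 \<or> (\<exists>f\<in>insert e D \<inter> out_cut G T\<^sub>0. head G f \<in> S)" for S
  proof -
    have "\<not> S \<inter> T \<subseteq> T\<^sub>0 \<or> (\<exists>f\<in>D \<inter> out_cut G T\<^sub>0. head G f \<in> S)"
      using that(2) *[of S] by blast
    then show ?thesis using ph that(1) unfolding phase_def by blast
  qed
  ultimately show ?thesis
    using ph unfolding phase_def by simp
qed

text \<open>The head is outside \<open>T\<close> and hence outside \<open>T\<^sub>0\<close>, so
  \<open>e\<close> is a new arc leaving \<open>T\<^sub>0\<close> and pays for the added element of
  the multiset.\<close>

lemma phase_push:
  assumes ph: "phase M\<^sub>0 T\<^sub>0 D M T" and e: "e \<in> arcs G" "e \<notin> D" "tail G e \<in> T\<^sub>0" "head G e \<notin> T"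
    and T': "greatest_tight (add_mset (head G e) M) T'"
  shows "phase M\<^sub>0 T\<^sub>0 (insert e D) (add_mset (head G e) M) T'"
proof -
  let ?v = "head G e"
  have T: "greatest_tight M T" and T0: "T\<^sub>0 \<subseteq> T" using ph by (auto simp: phase_def)
  have eT0: "e \<in> out_cut G T\<^sub>0" using e T0 by (auto simp: out_cut_def)
  have "insert e D \<inter> out_cut G T\<^sub>0 = insert e (D \<inter> out_cut G T\<^sub>0)" using eT0 by auto
  then have "card (insert e D \<inter> out_cut G T\<^sub>0) = Suc (card (D \<inter> out_cut G T\<^sub>0))"
    using e by simp
  moreover have TT: "T \<subseteq> T'" by (rule push_mono[OF T e(4) T'])
  moreover have "residual (add_mset ?v M) (S \<union> T') \<le> residual M\<^sub>0 (S \<union> T\<^sub>0) \<and>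
        (\<not> S \<inter> T' \<subseteq> T\<^sub>0 \<or> (\<exists>f\<in>insert e D \<inter> out_cut G T\<^sub>0. head G f \<in> S) \<longrightarrow>
           residual (add_mset ?v M) (S \<union> T') < residual M\<^sub>0 (S \<union> T\<^sub>0))"
    if S: "S \<subseteq> verts G - Y" for S
  proof -
    note sl = push_slack[OF T e(4) T' S]
    have old: "residual M (S \<union> T) \<le> residual M\<^sub>0 (S \<union> T\<^sub>0)"
      "\<not> S \<inter> T \<subseteq> T\<^sub>0 \<or> (\<exists>e\<in>D \<inter> out_cut G T\<^sub>0. head G e \<in> S) \<Longrightarrow>
           residual M (S \<union> T) < residual M\<^sub>0 (S \<union> T\<^sub>0)"
      using ph S unfolding phase_def by blast+
    show ?thesis
    proof (intro conjI impI)
      show "residual (add_mset ?v M) (S \<union> T') \<le> residual M\<^sub>0 (S \<union> T\<^sub>0)"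
        using sl(1) old(1) by (rule order_trans)
      \<comment> \<open>Either the reason for strictness was present before this push, or it arose
        now, and \<open>push_slack\<close> supplies the drop.\<close>
      assume "\<not> S \<inter> T' \<subseteq> T\<^sub>0 \<or> (\<exists>f\<in>insert e D \<inter> out_cut G T\<^sub>0. head G f \<in> S)"
      then consider "\<not> S \<inter> T \<subseteq> T\<^sub>0 \<or> (\<exists>e\<in>D \<inter> out_cut G T\<^sub>0. head G e \<in> S)"
        | "?v \<in> S \<or> \<not> S \<inter> T' \<subseteq> T" by blast
      then show "residual (add_mset ?v M) (S \<union> T') < residual M\<^sub>0 (S \<union> T\<^sub>0)"
        using sl old by cases (meson le_less_trans less_le_trans)+
    qed
  qed
  ultimately show ?thesis
    using ph T' T0 unfolding phase_def by auto
qed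

lemma phase_exists:
  assumes "greatest_tight M\<^sub>0 T\<^sub>0"
  shows "\<exists>M T. phase M\<^sub>0 T\<^sub>0 (arcs G) M T"
proof -
  have "\<exists>M T. phase M\<^sub>0 T\<^sub>0 D M T" if "finite D" "D \<subseteq> arcs G" for D
    using that
  proof (induction D rule: finite_induct)
    case (insert e D)
    then obtain M T where ph: "phase M\<^sub>0 T\<^sub>0 D M T" by auto
    show ?case
    proof (cases "tail G e \<in> T\<^sub>0 \<and> head G e \<notin> T")
      case True
      then have "\<exists>T'. greatest_tight (add_mset (head G e) M) T'"
        using ph by (intro greatest_tight_exists push_residual_nonneg) (auto simp: phase_def)
      then show ?thesis using phase_push[OF ph, of e] True insert by blast
    qed (use phase_skip[OF ph] in blast)
  qed (use assms phase_start in blast)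
  then show ?thesis by auto
qed

text \<open>The invariant after \<open>i\<close> of \<open>k\<close> phases: \<open>M\<close> has at
  most doubled in each phase, and every relevant cut not yet inside \<open>T\<close> has residual at
  most \<open>k - i\<close> after union with \<open>T\<close>. The addition on the left avoids
  truncated subtraction.\<close>

definition covering :: "nat \<Rightarrow> nat \<Rightarrow> 'a multiset \<Rightarrow> 'a set \<Rightarrow> bool" where
  "covering k i M T \<longleftrightarrow> greatest_tight M T \<and> X \<subseteq> T \<and> size M \<le> flow G X Y * 2 ^ i \<and>
     (\<forall>S. out_reachable_cut G X Y S \<and> card (out_cut G S) \<le> flow G X Y + k \<longrightarrow>
        S \<subseteq> T \<or> residual M (S \<union> T) + int i \<le> int k)"

lemma cut_subset: "is_XY_cut G X Y S \<Longrightarrow> S \<subseteq> verts G - Y"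
  by (auto simp: is_XY_cut_def)

lemma greatest_tight_is_cut: "greatest_tight M T \<Longrightarrow> X \<subseteq> T \<Longrightarrow> is_XY_cut G X Y T"
  using Y_verts by (auto simp: is_XY_cut_def greatest_tight_def)

text \<open>A minimum cut contains all vertices pushed from \<open>X\<close>, and its residual must
  stay nonnegative.\<close>

lemma size_pushes_le_flow:
  assumes "greatest_tight M T" "set_mset M \<subseteq> X"
  shows "size M \<le> flow G X Y"
proof -
  obtain R where R: "is_XY_cut G X Y R" "card (out_cut G R) = flow G X Y"
    using max_flow_min_cut by metis
  then have "0 \<le> residual M R" using assms cut_subset by (simp add: greatest_tight_def)
  moreover have "hits M R = size M"
    using R assms by (intro hits_eq_size) (auto simp: is_XY_cut_def)
  ultimately show ?thesis using R by (simp add: residual_def)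
qed

text \<open>\<open>T\<close> is a cut with \<open>size M\<close> leaving arcs, so
  \<open>size M\<close> is exactly the flow value. A cut with at most \<open>k\<close> arcs more has
  residual at most \<open>k\<close>, and uncrossing with the tight set \<open>T\<close> preserves
  this for the union.\<close>

lemma covering_start:
  assumes T: "greatest_tight M T" and M: "set_mset M \<subseteq> X" and XT: "X \<subseteq> T"
  shows "covering k 0 M T"
proof -
  have "flow G X Y \<le> card (out_cut G T)"
    using greatest_tight_is_cut[OF T XT] by (rule flow_le_cut)
  also have "\<dots> = size M"
    using T XT M hits_eq_size[of M T] by (auto simp: greatest_tight_def residual_def)
  finally have size: "size M = flow G X Y"
    using size_pushes_le_flow[OF T M] by simp
  have "residual M (S \<union> T) \<le> int k"
    if S: "out_reachable_cut G X Y S" "card (out_cut G S) \<le> flow G X Y + k" for S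
  proof -
    have cut: "is_XY_cut G X Y S" using S by (simp add: out_reachable_cut_def)
    have "S \<inter> T \<subseteq> verts G - Y" using T unfolding greatest_tight_def by blast
    then have "0 \<le> residual M (S \<inter> T)" "residual M T = 0"
      using T unfolding greatest_tight_def by blast+
    moreover have "hits M S = size M"
      using M cut by (intro hits_eq_size) (auto simp: is_XY_cut_def)
    then have "residual M S \<le> int k"
      using S size by (simp add: residual_def)
    ultimately show ?thesis using residual_submodular[of M S T] by linarith
  qed
  then show ?thesis using T XT size by (auto simp: covering_def)
qed

text \<open>Here out-reachability enters: a path from \<open>X\<close> to a vertex of
  \<open>S\<close> outside \<open>T\<close> that avoids the arcs leaving \<open>S\<close> stays in
  \<open>S\<close>, so an arc on which it leaves \<open>T\<close> has its head in
  \<open>S\<close>.\<close>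

lemma out_reachable_crosses:
  assumes S: "out_reachable_cut G X Y S" and XT: "X \<subseteq> T" and ST: "\<not> S \<subseteq> T"
  shows "\<exists>e\<in>out_cut G T. head G e \<in> S"
proof -
  let ?H = "delete_arcs G (out_cut G S)"
  have H: "verts ?H = verts G" "arcs ?H = arcs G - out_cut G S" "tail ?H = tail G" "head ?H = head G"
    by (simp_all add: delete_arcs_def)
  interpret H: wf_digraph ?H
    by unfold_locales (auto simp: H)
  obtain s where s: "s \<in> S" "s \<notin> T" using ST by auto
  then obtain x where x: "x \<in> X" "x \<rightarrow>\<^sup>*\<^bsub>?H\<^esub> s" using S by (auto simp: out_reachable_cut_def)
  have XS: "X \<subseteq> S" using S by (auto simp: out_reachable_cut_def is_XY_cut_def)
  have "v \<in> S \<and> (v \<notin> T \<longrightarrow> (\<exists>e\<in>out_cut G T. head G e \<in> S))" if "x \<rightarrow>\<^sup>*\<^bsub>?H\<^esub> v" for v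
    using that
  proof (induction rule: H.reachable_induct)
    case base
    then show ?case using x XT XS by auto
  next
    case (step u v)
    then obtain e where e: "e \<in> arcs G" "e \<notin> out_cut G S" "tail G e = u" "head G e = v"
      by (auto simp: arcs_ends_def arc_to_ends_def H)
    then have "v \<in> verts G" by auto
    then have "v \<in> S" using e step by (auto simp: out_cut_def)
    moreover have "e \<in> out_cut G T" if "v \<notin> T" "u \<in> T"
      using e that \<open>v \<in> verts G\<close> by (auto simp: out_cut_def)
    ultimately show ?case using step e by auto
  qed
  then show ?thesis using x s by auto
qed

text \<open>At most \<open>card (out_cut G T\<^sub>0)\<close> pushes occur, and tightness bounds
  this by \<open>size M\<^sub>0\<close>. A cut not inside \<open>T\<^sub>0\<close> owns the head of
  some processed leaving arc, so its residual drops by at least 1.\<close>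

lemma covering_step:
  assumes cov: "covering k i M\<^sub>0 T\<^sub>0" and ph: "phase M\<^sub>0 T\<^sub>0 (arcs G) M T"
  shows "covering k (Suc i) M T"
proof -
  have T0: "greatest_tight M\<^sub>0 T\<^sub>0" "X \<subseteq> T\<^sub>0" "size M\<^sub>0 \<le> flow G X Y * 2 ^ i"
    using cov by (auto simp: covering_def)
  have T: "greatest_tight M T" "T\<^sub>0 \<subseteq> T" using ph by (auto simp: phase_def)
  have "arcs G \<inter> out_cut G T\<^sub>0 = out_cut G T\<^sub>0" by (auto simp: out_cut_def)
  then have "size M \<le> size M\<^sub>0 + card (out_cut G T\<^sub>0)" using ph by (simp add: phase_def)
  also have "card (out_cut G T\<^sub>0) \<le> size M\<^sub>0"
    using T0 hits_le_size[of M\<^sub>0 T\<^sub>0] by (simp add: greatest_tight_def residual_def)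
  finally have "size M \<le> flow G X Y * 2 ^ Suc i" using T0 by simp
  moreover have "S \<subseteq> T \<or> residual M (S \<union> T) + int (Suc i) \<le> int k"
    if S: "out_reachable_cut G X Y S" "card (out_cut G S) \<le> flow G X Y + k" for S
  proof (cases "S \<subseteq> T\<^sub>0")
    case False
    then obtain e where "e \<in> out_cut G T\<^sub>0" "head G e \<in> S"
      using out_reachable_crosses S T0 by blast
    moreover from this have "e \<in> arcs G" by (simp add: out_cut_def)
    moreover have "S \<subseteq> verts G - Y" using S cut_subset by (auto simp: out_reachable_cut_def)
    ultimately have "residual M (S \<union> T) < residual M\<^sub>0 (S \<union> T\<^sub>0)"
      using ph unfolding phase_def by blast
    then show ?thesis using cov S False by (fastforce simp: covering_def)
  qed (use T in auto)
  ultimately show ?thesis using T T0 by (auto simp: covering_def)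
qed

text \<open>After \<open>k\<close> phases the residual of \<open>S \<union> T\<close> would be at
  most 0, which puts the union inside the greatest tight set.\<close>

lemma covering_result:
  assumes "covering k k M T"
  shows "is_XY_cut G X Y T" "card (out_cut G T) \<le> flow G X Y * 2 ^ k"
    "covers_important_cuts G X Y (flow G X Y + k) T"
proof -
  have T: "greatest_tight M T" "X \<subseteq> T" "size M \<le> flow G X Y * 2 ^ k"
    using assms by (auto simp: covering_def)
  show "is_XY_cut G X Y T" using T greatest_tight_is_cut by blast
  show "card (out_cut G T) \<le> flow G X Y * 2 ^ k"
    using T hits_le_size[of M T] by (simp add: greatest_tight_def residual_def)
  show "covers_important_cuts G X Y (flow G X Y + k) T"
    unfolding covers_important_cuts_def
  proof (intro allI impI)
    fix S assume "important_cut G X Y S \<and> card (out_cut G S) \<le> flow G X Y + k"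
    then have S: "out_reachable_cut G X Y S" "card (out_cut G S) \<le> flow G X Y + k"
      by (auto simp: important_cut_def)
    then have "S \<union> T \<subseteq> verts G - Y"
      using cut_subset T by (auto simp: out_reachable_cut_def greatest_tight_def)
    moreover have "S \<subseteq> T \<or> residual M (S \<union> T) \<le> 0"
      using assms S by (fastforce simp: covering_def)
    ultimately show "S \<subseteq> T"
      using tight_subset_greatest[OF T(1), of "S \<union> T"] by auto
  qed
qed

text \<open>For the pure existence claim, the sources of a maximum flow serve as the initial
  multiset; a minimum cut is tight for it, which forces \<open>X\<close> into
  \<open>T\<close>.\<close>

lemma covering_exists: "\<exists>M T. covering k i M T"
proof (induction i)
  case 0
  obtain F M R where FM: "unit_flow F M" and R: "is_XY_cut G X Y R" "card (out_cut G R) = size M"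
    using max_flow_min_cut by metis
  have "int (hits M S) \<le> int (card (out_cut G S))" if "S \<subseteq> verts G - Y" for S
  proof -
    have "int (hits M S) = net F S" using FM that by (simp add: unit_flow_def)
    also have "\<dots> \<le> int (card (out_cut G S))"
      \<comment> \<open>The difference of the two sides is the number of arcs leaving
        \<open>S\<close> after reversal of \<open>F\<close>, hence nonnegative.\<close>
      using FM cut_size_reverse[OF finite_arcs, of F "head G" "tail G" S]
      by (simp add: unit_flow_def card_out_cut net_def sum_subtractf)
    finally show ?thesis .
  qed
  then obtain T where T: "greatest_tight M T"
    using greatest_tight_exists[of M] by (auto simp: residual_def)
  have MX: "set_mset M \<subseteq> X" using FM by (simp add: unit_flow_def)
  then have "hits M R = size M" using R by (intro hits_eq_size) (auto simp: is_XY_cut_def)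
  then have "residual M R = 0" using R by (simp add: residual_def)
  then have "R \<subseteq> T" using tight_subset_greatest[OF T] R cut_subset by simp
  then have "X \<subseteq> T" using R by (auto simp: is_XY_cut_def)
  then show ?case using covering_start[OF T MX] by blast
next
  case (Suc i)
  then show ?case using phase_exists covering_step unfolding covering_def by metis
qed

end

section \<open>Running time of programs\<close>

text \<open>Total correctness with an upper bound on the time, so that estimates can be weakened and
  composed.\<close>

definition halts :: "prog \<Rightarrow> store \<Rightarrow> nat \<Rightarrow> (store \<Rightarrow> bool) \<Rightarrow> bool" where
  "halts p s c Q \<longleftrightarrow> (\<exists>t s'. exec p s t s' \<and> t \<le> c \<and> Q s')"

lemma halts_mono: "halts p s c Q \<Longrightarrow> c \<le> c' \<Longrightarrow> (\<And>s'. Q s' \<Longrightarrow> Q' s') \<Longrightarrow> halts p s c' Q'"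
  unfolding halts_def by (meson order_trans)

lemma exec_Nop_iff: "exec Nop s t s' \<longleftrightarrow> t = 1 \<and> s' = s"
  by (auto intro: exec.Nop[simplified] elim: exec_NopE)

lemma exec_Write_iff:
  "exec (Write a e f) s t s' \<longleftrightarrow> t = 1 \<and> s' = s(a := (s a)(eval_exp e s := eval_exp f s))"
  by (auto intro: exec.Write[simplified] elim: exec_WriteE)

lemma exec_Seq_iff:
  "exec (Seq p q) s t s' \<longleftrightarrow> (\<exists>t1 v t2. exec p s t1 v \<and> exec q v t2 s' \<and> t = t1 + t2)"
  by (blast intro: exec.Seq elim: exec_SeqE)

lemma exec_Cond_iff:
  "exec (Cond b p q) s t s' \<longleftrightarrow>
     (\<exists>t'. t = t' + 1 \<and> exec (if eval_test b s then p else q) s t' s')"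
  by (auto intro: exec.CondTrue[simplified] exec.CondFalse[simplified] elim: exec_CondE)

lemma halts_Nop [simp]: "halts Nop s c Q \<longleftrightarrow> 1 \<le> c \<and> Q s"
  by (auto simp: halts_def exec_Nop_iff)

lemma halts_Write [simp]:
  "halts (Write a e f) s c Q \<longleftrightarrow> 1 \<le> c \<and> Q (s(a := (s a)(eval_exp e s := eval_exp f s)))"
  by (auto simp: halts_def exec_Write_iff)

lemma halts_Cond [simp]:
  "halts (Cond b p q) s c Q \<longleftrightarrow> 1 \<le> c \<and> halts (if eval_test b s then p else q) s (c - 1) Q"
proof -
  let ?r = "if eval_test b s then p else q"
  have "halts (Cond b p q) s c Q \<longleftrightarrow> (\<exists>t s'. exec ?r s t s' \<and> t + 1 \<le> c \<and> Q s')"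
    unfolding halts_def exec_Cond_iff by blast
  moreover have "t + 1 \<le> c \<longleftrightarrow> 1 \<le> c \<and> t \<le> c - 1" for t by auto
  ultimately show ?thesis unfolding halts_def by (simp only:) blast
qed

lemma halts_Seq_iff:
  "halts (Seq p q) s c Q \<longleftrightarrow> (\<exists>t v. exec p s t v \<and> t \<le> c \<and> halts q v (c - t) Q)"
proof -
  have "t1 + t2 \<le> c \<longleftrightarrow> t1 \<le> c \<and> t2 \<le> c - t1" for t1 t2 :: nat by auto
  then show ?thesis
    unfolding halts_def exec_Seq_iff by blast
qed

lemma halts_Seq:
  assumes "halts p s c (\<lambda>s'. halts q s' d Q)" "c + d \<le> b"
  shows "halts (Seq p q) s b Q"
proof -
  obtain t v where *: "exec p s t v" "t \<le> c" "halts q v d Q"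
    using assms(1) unfolding halts_def[of p] by blast
  then have "halts q v (b - t) Q" using assms(2) by (auto elim: halts_mono)
  moreover have "t \<le> b" using * assms(2) by simp
  ultimately show ?thesis using * unfolding halts_Seq_iff by blast
qed

text \<open>As a rewrite rule it brings the first elementary command to the front, where the rules
  for sequences apply.\<close>

lemma halts_Seq_assoc [simp]: "halts (Seq (Seq p q) r) s c Q \<longleftrightarrow> halts (Seq p (Seq q r)) s c Q"
proof -
  have "exec (Seq (Seq p q) r) s t s' \<longleftrightarrow> exec (Seq p (Seq q r)) s t s'" for t s'
  proof
    assume "exec (Seq (Seq p q) r) s t s'"
    then obtain t1 t2 t3 u v where "exec p s t1 u" "exec q u t2 v" "exec r v t3 s'" "t = t1 + (t2 + t3)"
      by (auto simp: exec_Seq_iff)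
    then show "exec (Seq p (Seq q r)) s t s'" unfolding exec_Seq_iff by blast
  next
    assume "exec (Seq p (Seq q r)) s t s'"
    then obtain t1 t2 t3 u v where "exec p s t1 u" "exec q u t2 v" "exec r v t3 s'" "t = (t1 + t2) + t3"
      by (auto simp: exec_Seq_iff)
    then show "exec (Seq (Seq p q) r) s t s'" unfolding exec_Seq_iff by blast
  qed
  then show ?thesis by (simp add: halts_def)
qed

lemma halts_Seq_Nop [simp]: "halts (Seq Nop q) s c Q \<longleftrightarrow> 1 \<le> c \<and> halts q s (c - 1) Q"
  by (simp add: halts_Seq_iff exec_Nop_iff)

lemma halts_Seq_Write [simp]:
  "halts (Seq (Write a e f) q) s c Q \<longleftrightarrow>
     1 \<le> c \<and> halts q (s(a := (s a)(eval_exp e s := eval_exp f s))) (c - 1) Q"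
  by (simp add: halts_Seq_iff exec_Write_iff)

lemma halts_Seq_Cond [simp]:
  "halts (Seq (Cond b p q) r) s c Q \<longleftrightarrow>
     1 \<le> c \<and> halts (Seq (if eval_test b s then p else q) r) s (c - 1) Q"
proof -
  let ?r = "if eval_test b s then p else q"
  have "halts (Seq (Cond b p q) r) s c Q \<longleftrightarrow>
      (\<exists>t v. exec ?r s t v \<and> t + 1 \<le> c \<and> halts r v (c - (t + 1)) Q)"
    unfolding halts_Seq_iff exec_Cond_iff by blast
  moreover have "t + 1 \<le> c \<longleftrightarrow> 1 \<le> c \<and> t \<le> c - 1" "c - (t + 1) = c - 1 - t" for t by auto
  ultimately show ?thesis unfolding halts_Seq_iff by (simp only:) blast
qed

text \<open>The first argument of the invariant is a potential that pays for the iterations.\<close>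

lemma halts_Loop:
  assumes "I n s"
    and step: "\<And>n s. I n s \<Longrightarrow> eval_test b s \<Longrightarrow>
      \<exists>c. halts p s c (\<lambda>s'. \<exists>n'. I n' s' \<and> n' + c + 1 \<le> n)"
  shows "halts (Loop b p) s (n + 1) (\<lambda>s'. (\<exists>n'. I n' s') \<and> \<not> eval_test b s')"
  using assms(1)
proof (induction n arbitrary: s rule: less_induct)
  case (less n)
  show ?case
  proof (cases "eval_test b s")
    case True
    with step less.prems obtain c t s' n' where *:
      "exec p s t s'" "t \<le> c" "I n' s'" "n' + c + 1 \<le> n" unfolding halts_def by blast
    then obtain u s'' where "exec (Loop b p) s' u s''" "u \<le> n' + 1" "\<exists>n'. I n' s''" "\<not> eval_test b s''"
      using less.IH[of n' s'] unfolding halts_def by auto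
    with * exec.LoopTrue[OF True, of p t s' u s''] show ?thesis
      unfolding halts_def by (intro exI[of _ "t + u + 1"] exI[of _ s'']) auto
  next
    case False
    with less.prems show ?thesis
      using exec.LoopFalse[OF False, of p]
      unfolding halts_def by (intro exI[of _ 1] exI[of _ s]) auto
  qed
qed

abbreviation var :: "nat \<Rightarrow> exp" where
  "var a \<equiv> Read a (Const 0)"

abbreviation set_var :: "nat \<Rightarrow> exp \<Rightarrow> prog" where
  "set_var a e \<equiv> Write a (Const 0) e"

definition for_arcs :: "nat \<Rightarrow> prog \<Rightarrow> prog" where
  "for_arcs a p = Seq (set_var a (Const 0))
     (Loop (Less (var a) (Read 0 (Const 1))) (Seq p (set_var a (Inc (var a)))))"

text \<open>Amortized version, for loops with a few expensive iterations. The 2 per iteration pays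
  for the increment and the loop test, the final 2 for the initial assignment and the failing
  test.\<close>

lemma halts_for_arcs_potential:
  assumes start: "I 0 n (s(a := (s a)(0 := 0)))"
    and m: "\<And>j n s. I j n s \<Longrightarrow> s 0 1 = m"
    and step: "\<And>j n s. I j n s \<Longrightarrow> j < m \<Longrightarrow> s a 0 = j \<Longrightarrow>
      \<exists>c. halts p s c (\<lambda>s'. s' a 0 = j \<and> (\<exists>n'. I (Suc j) n' (s'(a := (s' a)(0 := Suc j))) \<and> n' + c + 2 \<le> n))"
  shows "halts (for_arcs a p) s (n + 2) (\<lambda>s'. \<exists>n'. I m n' s')"
proof -
  let ?J = "\<lambda>n s. \<exists>j. I j n s \<and> s a 0 = j \<and> j \<le> m"
  have "halts (Loop (Less (var a) (Read 0 (Const 1))) (Seq p (set_var a (Inc (var a)))))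
      (s(a := (s a)(0 := 0))) (n + 1)
      (\<lambda>s'. (\<exists>n'. ?J n' s') \<and> \<not> eval_test (Less (var a) (Read 0 (Const 1))) s')"
  proof (rule halts_Loop)
    show "?J n (s(a := (s a)(0 := 0)))" using start by auto
  next
    fix n s assume "?J n s" and test: "eval_test (Less (var a) (Read 0 (Const 1))) s"
    then obtain j where j: "I j n s" "s a 0 = j" by auto
    then have "j < m" using test m[OF j(1)] by simp
    from step[OF j(1) this j(2)] obtain c where c:
      "halts p s c (\<lambda>s'. s' a 0 = j \<and> (\<exists>n'. I (Suc j) n' (s'(a := (s' a)(0 := Suc j))) \<and> n' + c + 2 \<le> n))"
      by blast
    have "halts (Seq p (set_var a (Inc (var a)))) s (c + 1) (\<lambda>s'. \<exists>n'. ?J n' s' \<and> n' + (c + 1) + 1 \<le> n)"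
      using c \<open>j < m\<close>
      by (intro halts_Seq[of _ _ c _ 1]) (auto elim!: halts_mono simp: Suc_le_eq)
    then show "\<exists>c. halts (Seq p (set_var a (Inc (var a)))) s c (\<lambda>s'. \<exists>n'. ?J n' s' \<and> n' + c + 1 \<le> n)"
      by blast
  qed
  then have "halts (Loop (Less (var a) (Read 0 (Const 1))) (Seq p (set_var a (Inc (var a)))))
      (s(a := (s a)(0 := 0))) (n + 1) (\<lambda>s'. \<exists>n'. I m n' s')"
  proof (rule halts_mono)
    fix s' assume "(\<exists>n'. ?J n' s') \<and> \<not> eval_test (Less (var a) (Read 0 (Const 1))) s'"
    then obtain n' where n': "I (s' a 0) n' s'" "s' a 0 \<le> m" "s' 0 1 \<le> s' a 0" by (auto simp: not_less)
    then have "s' a 0 = m" using m[OF n'(1)] by simp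
    then show "\<exists>n'. I m n' s'" using n' by auto
  qed simp
  then show ?thesis by (simp add: for_arcs_def)
qed

lemma halts_for_arcs:
  assumes start: "I 0 (s(a := (s a)(0 := 0)))"
    and m: "\<And>j s. I j s \<Longrightarrow> s 0 1 = m"
    and step: "\<And>j s. I j s \<Longrightarrow> j < m \<Longrightarrow> s a 0 = j \<Longrightarrow>
      halts p s c (\<lambda>s'. s' a 0 = j \<and> I (Suc j) (s'(a := (s' a)(0 := Suc j))))"
  shows "halts (for_arcs a p) s ((c + 2) * m + 2) (I m)"
proof -
  have "halts (for_arcs a p) s ((c + 2) * m + 2)
      (\<lambda>s'. \<exists>n'. I m s' \<and> m \<le> m \<and> n' = (c + 2) * (m - m))"
  proof (rule halts_for_arcs_potential[where I = "\<lambda>j n s. I j s \<and> j \<le> m \<and> n = (c + 2) * (m - j)"])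
    fix j n s assume *: "I j s \<and> j \<le> m \<and> n = (c + 2) * (m - j)" and j: "j < m" "s a 0 = j"
    have "m - j = Suc (m - Suc j)" using j by simp
    then have "n = (c + 2) * (m - Suc j) + c + 2" using * by (simp add: algebra_simps)
    then have "halts p s c (\<lambda>s'. s' a 0 = j \<and> (\<exists>n'. (I (Suc j) (s'(a := (s' a)(0 := Suc j))) \<and>
        Suc j \<le> m \<and> n' = (c + 2) * (m - Suc j)) \<and> n' + c + 2 \<le> n))"
      using step[of j s] * j by (auto elim!: halts_mono)
    then show "\<exists>c'. halts p s c' (\<lambda>s'. s' a 0 = j \<and> (\<exists>n'. (I (Suc j) (s'(a := (s' a)(0 := Suc j))) \<and>
        Suc j \<le> m \<and> n' = (c + 2) * (m - Suc j)) \<and> n' + c' + 2 \<le> n))"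
      by blast
  next
    fix j n s assume "I j s \<and> j \<le> m \<and> n = (c + 2) * (m - j)"
    then show "s 0 1 = m" using m by blast
  qed (use start in simp)
  then show ?thesis by (auto elim: halts_mono)
qed

section \<open>The program\<close>

text \<open>
  Arrays \<open>5\<close> and \<open>6\<close> are the ends of the arcs in the current orientation. The arcs with head \<open>v\<close>
  form a linked list with first element \<open>7[v]\<close> and successors \<open>8[e]\<close>; arc \<open>e\<close> is stored as \<open>e + 1\<close>
  and \<open>0\<close> ends the list. Array \<open>9\<close> marks the visited vertices, which are listed in the queue \<open>10\<close>
  between the positions \<open>12\<close> and \<open>13\<close>, and \<open>11[v]\<close> is the arc through which \<open>v\<close> was visited.
  Variable \<open>14\<close> points to the arc being scanned, \<open>15\<close> and \<open>16\<close> are loop counters, \<open>17\<close> counts the phases,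
  and \<open>18\<close> and \<open>19\<close> are the vertex and the arc at which a push has arrived.
\<close>

definition enqueue :: "exp \<Rightarrow> prog" where
  "enqueue v = Seq (Write 10 (var 13) v) (Seq (set_var 13 (Inc (var 13))) (Write 9 v (Const 1)))"

text \<open>Only cells of ends of arcs are cleared; a pass over all vertices would not fit the time
  bound.\<close>

definition reset_prog :: prog where
  "reset_prog = for_arcs 15
     (Seq (Write 7 (Read 1 (var 15)) (Const 0)) (Seq (Write 7 (Read 2 (var 15)) (Const 0))
     (Seq (Write 9 (Read 1 (var 15)) (Const 0)) (Write 9 (Read 2 (var 15)) (Const 0)))))"

text \<open>The search runs backwards, so it starts from the vertices of \<open>Y\<close>; the mark
  prevents repeated entries.\<close>

definition enqueue_target :: "exp \<Rightarrow> prog" where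
  "enqueue_target v = Cond (Conj (Neg (Equal (Read 4 v) (Const 0))) (Equal (Read 9 v) (Const 0))) (enqueue v) Nop"

definition link_prog :: prog where
  "link_prog = for_arcs 15
     (Seq (Write 8 (var 15) (Read 7 (Read 6 (var 15)))) (Seq (Write 7 (Read 6 (var 15)) (Inc (var 15)))
     (Seq (enqueue_target (Read 1 (var 15))) (enqueue_target (Read 2 (var 15))))))"

text \<open>Two nested loops flattened into one: a step either dequeues a vertex, when the current
  list is exhausted, or scans one arc. A single potential can then pay for everything.\<close>

definition scan_prog :: prog where
  "scan_prog = Loop (Neg (Conj (Equal (var 14) (Const 0)) (Neg (Less (var 12) (var 13)))))
     (Cond (Equal (var 14) (Const 0))
        (Seq (set_var 14 (Read 7 (Read 10 (var 12)))) (set_var 12 (Inc (var 12))))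
        (Seq (Cond (Equal (Read 9 (Read 5 (Dec (var 14)))) (Const 0))
               (Seq (Write 11 (Read 5 (Dec (var 14))) (Dec (var 14))) (enqueue (Read 5 (Dec (var 14))))) Nop)
             (set_var 14 (Read 8 (Dec (var 14))))))"

definition search_prog :: prog where
  "search_prog = Seq reset_prog (Seq (set_var 12 (Const 0)) (Seq (set_var 13 (Const 0))
     (Seq (set_var 14 (Const 0)) (Seq link_prog scan_prog))))"

text \<open>Follows the search forest to \<open>Y\<close> and reverses its arcs. Variable
  \<open>18\<close> receives the old head before the ends are swapped and so serves as the temporary
  of the swap.\<close>

definition push_prog :: prog where
  "push_prog = Loop (Equal (Read 4 (var 18)) (Const 0))
     (Seq (set_var 19 (Read 11 (var 18))) (Seq (set_var 18 (Read 6 (var 19)))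
     (Seq (Write 6 (var 19) (Read 5 (var 19))) (Write 5 (var 19) (var 18)))))"

text \<open>With \<open>a = 1\<close> the tails of arcs are pushed, which produces the flow from
  \<open>X\<close>; with \<open>a = 2\<close> the heads are pushed, which is a covering phase. Array
  \<open>3\<close> stays fixed meanwhile and holds the starting set.\<close>

definition phase_prog :: "nat \<Rightarrow> prog" where
  "phase_prog a = for_arcs 16
     (Cond (Conj (Neg (Equal (Read 3 (Read 1 (var 16))) (Const 0)))
                 (Neg (Equal (Read 9 (Read a (var 16))) (Const 0))))
        (Seq (set_var 18 (Read a (var 16))) (Seq push_prog search_prog)) Nop)"

definition mark_unvisited :: "exp \<Rightarrow> prog" where
  "mark_unvisited v = Cond (Equal (Read 9 v) (Const 0)) (Write 3 v (Const 1)) Nop"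

definition update_prog :: prog where
  "update_prog = for_arcs 15 (Seq (mark_unvisited (Read 1 (var 15))) (mark_unvisited (Read 2 (var 15))))"

definition copy_prog :: prog where
  "copy_prog = for_arcs 15 (Seq (Write 5 (var 15) (Read 1 (var 15))) (Write 6 (var 15) (Read 2 (var 15))))"

definition cover_prog :: prog where
  "cover_prog = Seq (Seq copy_prog (Seq search_prog (Seq (phase_prog 1) update_prog)))
     (Loop (Less (var 17) (Read 0 (Const 2)))
        (Seq (phase_prog 2) (Seq update_prog (set_var 17 (Inc (var 17))))))"

section \<open>Frame conditions, linked lists and numbered instances\<close>

definition agree :: "nat set \<Rightarrow> store \<Rightarrow> store \<Rightarrow> bool" where
  "agree D s s' \<longleftrightarrow> (\<forall>a. a \<notin> D \<longrightarrow> s' a = s a)"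

lemma agree_refl [simp]: "agree D s s"
  by (simp add: agree_def)

lemma agree_upd [simp]: "a \<in> D \<Longrightarrow> agree D s (s'(a := f)) \<longleftrightarrow> agree D s s'"
  by (auto simp: agree_def)

lemma agree_trans: "agree D s s' \<Longrightarrow> agree E s' s'' \<Longrightarrow> D \<subseteq> F \<Longrightarrow> E \<subseteq> F \<Longrightarrow> agree F s s''"
  by (force simp: agree_def)

text \<open>\<open>last_in ch v b a\<close>: \<open>a\<close> is the linked list pointer to the greatest arc below \<open>b\<close> with head \<open>v\<close>.\<close>

definition last_in :: "(nat \<Rightarrow> nat) \<Rightarrow> nat \<Rightarrow> nat \<Rightarrow> nat \<Rightarrow> bool" where
  "last_in ch v b a \<longleftrightarrow> a \<le> b \<and> (\<forall>e. a \<le> e \<and> e < b \<longrightarrow> ch e \<noteq> v) \<and> (0 < a \<longrightarrow> ch (a - 1) = v)"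

lemma last_in_Suc:
  assumes "last_in ch v j a"
  shows "last_in ch v (Suc j) (if ch j = v then Suc j else a)"
  using assms by (auto simp: last_in_def less_Suc_eq)

locale numbered_instance = terminal_digraph G X Y for G :: "(nat, nat) pre_digraph" and X Y +
  assumes numbered: "numbered G"
begin

definition m :: nat where
  "m = card (arcs G)"

text \<open>The vertices with incident arcs. The graph search stays among them, and there are at
  most \<open>2 * m\<close>.\<close>

definition N :: "nat set" where
  "N = tail G ` arcs G \<union> head G ` arcs G"

lemma in_arcs_iff [simp]: "e \<in> arcs G \<longleftrightarrow> e < m"
proof -
  have "arcs G = {..<m}" using numbered unfolding numbered_def m_def by blast
  then show ?thesis by (metis lessThan_iff)
qed

lemma finite_N [simp]: "finite N"
  by (simp add: N_def)

lemma card_N: "card N \<le> 2 * m"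
proof -
  have "card N \<le> card (tail G ` arcs G) + card (head G ` arcs G)" unfolding N_def by (rule card_Un_le)
  also have "\<dots> \<le> card (arcs G) + card (arcs G)" by (intro add_mono card_image_le) simp_all
  finally show ?thesis by (simp add: m_def)
qed

lemma ends_in_N [simp]: "e < m \<Longrightarrow> tail G e \<in> N" "e < m \<Longrightarrow> head G e \<in> N"
  by (simp_all add: N_def)

lemma N_verts: "N \<subseteq> verts G"
  by (auto simp: N_def)

text \<open>Array \<open>3\<close> is absent because the result overwrites it.\<close>

definition input_kept :: "store \<Rightarrow> bool" where
  "input_kept s \<longleftrightarrow> s 0 (Suc 0) = m \<and> (\<forall>e<m. s 1 e = tail G e \<and> s 2 e = head G e) \<and>
     (\<forall>v. s 4 v \<noteq> 0 \<longleftrightarrow> v \<in> Y)"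

lemma input_kept_agree:
  assumes "input_kept s" "agree D s s'" "D \<inter> {0, 1, 2, 4} = {}"
  shows "input_kept s'"
proof -
  have "s' 0 = s 0" "s' 1 = s 1" "s' 2 = s 2" "s' 4 = s 4"
    using assms(2,3) by (auto simp: agree_def)
  then show ?thesis using assms(1) by (simp add: input_kept_def)
qed

definition orientation :: "(nat \<Rightarrow> nat) \<Rightarrow> (nat \<Rightarrow> nat) \<Rightarrow> bool" where
  "orientation ct ch \<longleftrightarrow>
     (\<forall>e<m. ct e = tail G e \<and> ch e = head G e \<or> ct e = head G e \<and> ch e = tail G e)"

lemma orientation_in_N:
  "orientation ct ch \<Longrightarrow> e < m \<Longrightarrow> ct e \<in> N"
  "orientation ct ch \<Longrightarrow> e < m \<Longrightarrow> ch e \<in> N"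
  by (auto simp: orientation_def dest!: spec[of _ e])

subsection \<open>Search\<close>

text \<open>Dequeued vertices stay in the array, so that it records the whole search order.\<close>

definition queue :: "(nat \<Rightarrow> nat) \<Rightarrow> nat \<Rightarrow> (nat \<Rightarrow> nat) \<Rightarrow> bool" where
  "queue q n vis \<longleftrightarrow> inj_on q {..<n} \<and> q ` {..<n} = {v \<in> N. vis v \<noteq> 0}"

lemma queue_add:
  assumes "queue q n vis" "u \<in> N" "vis u = 0"
  shows "queue (q(n := u)) (Suc n) (vis(u := Suc 0))"
proof -
  have im: "q ` {..<n} = {v \<in> N. vis v \<noteq> 0}" using assms by (simp add: queue_def)
  then have "u \<notin> q ` {..<n}" using assms by auto
  then have "inj_on (q(n := u)) {..<Suc n}"
    using assms(1) by (simp add: queue_def lessThan_Suc inj_on_def image_iff) metis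
  moreover have "(q(n := u)) ` {..<Suc n} = insert u (q ` {..<n})"
    by (auto simp: lessThan_Suc)
  ultimately show ?thesis using assms im by (auto simp: queue_def)
qed

lemma queue_le: "queue q n vis \<Longrightarrow> n \<le> card N"
  unfolding queue_def by (metis (no_types, lifting) card_image card_lessThan card_mono finite_N mem_Collect_eq subsetI)

lemma queueD: "queue q n vis \<Longrightarrow> i < n \<Longrightarrow> q i \<in> N \<and> vis (q i) \<noteq> 0"
  unfolding queue_def by blast

lemma queue_nth_eq: "queue q n vis \<Longrightarrow> i < n \<Longrightarrow> j < n \<Longrightarrow> q i = q j \<Longrightarrow> i = j"
  unfolding queue_def inj_on_def by blast

lemma queue_visited: "queue q n vis \<Longrightarrow> v \<in> N \<Longrightarrow> vis v \<noteq> 0 \<Longrightarrow> \<exists>i<n. q i = v"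
  unfolding queue_def by (smt (verit) image_iff lessThan_iff mem_Collect_eq)

text \<open>The search forest: a parent arc leads to an earlier queue position, so following parents
  terminates in \<open>Y\<close>.\<close>

definition parents ::
    "(nat \<Rightarrow> nat) \<Rightarrow> (nat \<Rightarrow> nat) \<Rightarrow> (nat \<Rightarrow> nat) \<Rightarrow> (nat \<Rightarrow> nat) \<Rightarrow> nat \<Rightarrow> bool" where
  "parents ct ch q par n \<longleftrightarrow> (\<forall>i<n. q i \<notin> Y \<longrightarrow>
     par (q i) < m \<and> ct (par (q i)) = q i \<and> (\<exists>j<i. ch (par (q i)) = q j))"

text \<open>Says that the visited vertices of \<open>N\<close> are those that can reach
  \<open>Y\<close>: \<open>parents\<close> gives soundness, the last two conjuncts
  completeness.\<close>

definition searched ::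
    "(nat \<Rightarrow> nat) \<Rightarrow> (nat \<Rightarrow> nat) \<Rightarrow> (nat \<Rightarrow> nat) \<Rightarrow> (nat \<Rightarrow> nat) \<Rightarrow> (nat \<Rightarrow> nat) \<Rightarrow> nat \<Rightarrow> bool" where
  "searched ct ch vis q par n \<longleftrightarrow> queue q n vis \<and> parents ct ch q par n \<and>
     (\<forall>v\<in>N \<inter> Y. vis v \<noteq> 0) \<and> (\<forall>e<m. vis (ch e) \<noteq> 0 \<longrightarrow> vis (ct e) \<noteq> 0)"

definition linked :: "(nat \<Rightarrow> nat) \<Rightarrow> nat \<Rightarrow> (nat \<Rightarrow> nat) \<Rightarrow> (nat \<Rightarrow> nat) \<Rightarrow> bool" where
  "linked ch j first nxt \<longleftrightarrow> (\<forall>v\<in>N. last_in ch v j (first v)) \<and> (\<forall>e<j. last_in ch (ch e) e (nxt e))"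

lemma linked_Suc:
  assumes "linked ch j first nxt" "ch j \<in> N"
  shows "linked ch (Suc j) (first(ch j := Suc j)) (nxt(j := first (ch j)))"
proof -
  have "last_in ch v (Suc j) ((first(ch j := Suc j)) v)" if "v \<in> N" for v
    using assms that last_in_Suc[of ch v j "first v"] by (auto simp: linked_def split: if_splits)
  then show ?thesis
    using assms by (auto simp: linked_def less_Suc_eq)
qed

text \<open>The vertex being scanned is at position \<open>qh - 1\<close>, and \<open>a = 0\<close>
  means that its list is exhausted. An arc into a dequeued vertex has a visited tail unless it is
  still pending in the current list.\<close>

definition scanning where
  "scanning ct ch vis q par qh qt a \<longleftrightarrow> queue q qt vis \<and> qh \<le> qt \<and> parents ct ch q par qt \<and>
     (\<forall>v\<in>N \<inter> Y. vis v \<noteq> 0) \<and> (0 < a \<longrightarrow> 0 < qh \<and> a \<le> m \<and> ch (a - 1) = q (qh - 1)) \<and>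
     (\<forall>e<m. ch e \<in> q ` {..<qh} \<longrightarrow> vis (ct e) \<noteq> 0 \<or> (e < a \<and> ch e = q (qh - 1)))"

text \<open>Counts a bound on the vertices still to be dequeued, the arcs into vertices not yet
  dequeued, and the pending arcs of the current list.\<close>

definition scan_potential where
  "scan_potential ch q qh a =
     (card N - qh) + card {e. e < m \<and> ch e \<notin> q ` {..<qh}} + card {e. e < a \<and> ch e = q (qh - 1)}"

lemma scanning_dequeue:
  assumes sc: "scanning ct ch vis q par qh qt 0" and lk: "linked ch m first nxt" and qh: "qh < qt"
  shows "scanning ct ch vis q par (Suc qh) qt (first (q qh))"
    and "scan_potential ch q (Suc qh) (first (q qh)) + 1 \<le> scan_potential ch q qh 0"
proof -
  have q: "queue q qt vis" using sc by (simp add: scanning_def)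
  have w: "q qh \<in> N" using queueD[OF q qh] by simp
  then have last: "last_in ch (q qh) m (first (q qh))" using lk by (simp add: linked_def)
  then have less: "e < first (q qh)" if "e < m" "ch e = q qh" for e
    using that by (auto simp: last_in_def not_less[symmetric])
  show "scanning ct ch vis q par (Suc qh) qt (first (q qh))"
    using sc qh last less by (auto simp: scanning_def lessThan_Suc last_in_def)
  have notin: "q qh \<notin> q ` {..<qh}"
  proof
    assume "q qh \<in> q ` {..<qh}"
    then obtain i where "i < qh" "q qh = q i" by auto
    then show False using queue_nth_eq[OF q, of qh i] qh by simp
  qed
  have le: "first (q qh) \<le> m" using last by (simp add: last_in_def)
  \<comment> \<open>Dequeuing moves the arcs into the new vertex from the second summand of the
    potential to the third, while the first summand falls by 1.\<close>
  have "{e. e < m \<and> ch e \<notin> q ` {..<qh}} =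
      {e. e < m \<and> ch e \<notin> q ` {..<Suc qh}} \<union> {e. e < first (q qh) \<and> ch e = q qh}"
  proof (intro set_eqI)
    fix e
    show "e \<in> {e. e < m \<and> ch e \<notin> q ` {..<qh}} \<longleftrightarrow>
        e \<in> {e. e < m \<and> ch e \<notin> q ` {..<Suc qh}} \<union> {e. e < first (q qh) \<and> ch e = q qh}"
      using notin less[of e] le by (cases "ch e = q qh") (auto simp: lessThan_Suc)
  qed
  moreover have "card ({e. e < m \<and> ch e \<notin> q ` {..<Suc qh}} \<union> {e. e < first (q qh) \<and> ch e = q qh})
      = card {e. e < m \<and> ch e \<notin> q ` {..<Suc qh}} + card {e. e < first (q qh) \<and> ch e = q qh}"
    by (rule card_Un_disjoint) (auto simp: lessThan_Suc)
  moreover have "qh < card N" using queue_le[OF q] qh by simp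
  ultimately show "scan_potential ch q (Suc qh) (first (q qh)) + 1 \<le> scan_potential ch q qh 0"
    by (simp add: scan_potential_def)
qed

text \<open>The new vertex goes behind the dequeued part, so the potential is unchanged, and its
  parent arc leads to the vertex being scanned. The arc stays pending until the pointer
  moves.\<close>

lemma scanning_visit:
  assumes sc: "scanning ct ch vis q par qh qt a" and a: "0 < a" and or: "orientation ct ch"
    and new: "vis (ct (a - 1)) = 0"
  shows "scanning ct ch (vis(ct (a - 1) := Suc 0)) (q(qt := ct (a - 1))) (par(ct (a - 1) := a - 1)) qh (Suc qt) a"
    and "scan_potential ch (q(qt := ct (a - 1))) qh a' = scan_potential ch q qh a'"
proof -
  let ?u = "ct (a - 1)" and ?q = "q(qt := ct (a - 1))"
  have q: "queue q qt vis" and qh: "0 < qh" "qh \<le> qt" and am: "a - 1 < m" and w: "ch (a - 1) = q (qh - 1)"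
    using sc a by (auto simp: scanning_def)
  have u: "?u \<in> N" using orientation_in_N[OF or am] by simp
  have same: "?q i = q i" if "i < qh" for i using that qh by simp
  then have im: "?q ` {..<qh} = q ` {..<qh}" by auto
  have w': "?q (qh - 1) = q (qh - 1)" using qh by (intro same) simp
  have old: "q i \<noteq> ?u" if "i < qt" for i using queueD[OF q that] new by metis
  have "parents ct ch ?q (par(?u := a - 1)) (Suc qt)"
    unfolding parents_def
  proof (intro allI impI)
    fix i assume i: "i < Suc qt" "?q i \<notin> Y"
    show "(par(?u := a - 1)) (?q i) < m \<and> ct ((par(?u := a - 1)) (?q i)) = ?q i \<and>
        (\<exists>j<i. ch ((par(?u := a - 1)) (?q i)) = ?q j)"
    proof (cases "i = qt")
      case True
      then show ?thesis using am w w' qh by (auto intro!: exI[of _ "qh - 1"])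
    next
      case False
      then have "i < qt" using i by simp
      moreover have "parents ct ch q par qt" using sc by (simp add: scanning_def)
      moreover have "q i \<notin> Y" using i False by simp
      ultimately obtain j where "par (q i) < m" "ct (par (q i)) = q i" "j < i" "ch (par (q i)) = q j"
        unfolding parents_def by blast
      then show ?thesis using old[of i] \<open>i < qt\<close> by (auto intro!: exI[of _ j])
    qed
  qed
  then show "scanning ct ch (vis(?u := Suc 0)) ?q (par(?u := a - 1)) qh (Suc qt) a"
    using sc queue_add[OF q u new] qh unfolding scanning_def im w' by auto
  show "scan_potential ch ?q qh a' = scan_potential ch q qh a'"
    unfolding scan_potential_def im w' ..
qed

lemma scanning_advance:
  assumes sc: "scanning ct ch vis q par qh qt a" and a: "0 < a" and lk: "linked ch m first nxt"
    and old: "vis (ct (a - 1)) \<noteq> 0"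
  shows "scanning ct ch vis q par qh qt (nxt (a - 1))"
    and "scan_potential ch q qh (nxt (a - 1)) + 1 \<le> scan_potential ch q qh a"
proof -
  let ?a = "nxt (a - 1)"
  have am: "a - 1 < m" and w: "ch (a - 1) = q (qh - 1)" and qh: "0 < qh"
    using sc a by (auto simp: scanning_def)
  have last: "last_in ch (q (qh - 1)) (a - 1) ?a" using lk am w by (metis linked_def)
  \<comment> \<open>By \<open>last_in\<close>, no arc strictly between the next list entry and
    \<open>a - 1\<close> has this head, so exactly one pending arc disappears.\<close>
  have eq: "{e. e < a \<and> ch e = q (qh - 1)} = insert (a - 1) {e. e < ?a \<and> ch e = q (qh - 1)}"
  proof (intro set_eqI)
    fix e
    have "e < ?a" if "e < a" "ch e = q (qh - 1)" "e \<noteq> a - 1"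
    proof (rule ccontr)
      assume "\<not> e < ?a"
      moreover have "e < a - 1" using that by simp
      ultimately show False using last that by (auto simp: last_in_def)
    qed
    moreover have "?a \<le> a - 1" using last by (simp add: last_in_def)
    ultimately show "e \<in> {e. e < a \<and> ch e = q (qh - 1)} \<longleftrightarrow>
        e \<in> insert (a - 1) {e. e < ?a \<and> ch e = q (qh - 1)}"
      using a w by auto
  qed
  have "vis (ct e) \<noteq> 0 \<or> e < ?a \<and> ch e = q (qh - 1)" if "e < m" "ch e \<in> q ` {..<qh}" for e
  proof -
    have "vis (ct e) \<noteq> 0 \<or> e \<in> {e. e < a \<and> ch e = q (qh - 1)}"
      using sc that unfolding scanning_def by blast
    then show ?thesis using old unfolding eq by auto
  qed
  moreover have "0 < ?a \<longrightarrow> ?a \<le> m \<and> ch (?a - 1) = q (qh - 1)"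
    using last am by (auto simp: last_in_def)
  ultimately show "scanning ct ch vis q par qh qt ?a"
    using sc qh unfolding scanning_def by blast
  have "a - 1 \<notin> {e. e < ?a \<and> ch e = q (qh - 1)}" using last by (auto simp: last_in_def)
  then have "card {e. e < a \<and> ch e = q (qh - 1)} = Suc (card {e. e < ?a \<and> ch e = q (qh - 1)})"
    unfolding eq by (intro card_insert_disjoint) simp_all
  then show "scan_potential ch q qh ?a + 1 \<le> scan_potential ch q qh a"
    by (simp add: scan_potential_def)
qed

lemma scanning_end:
  assumes sc: "scanning ct ch vis q par qh qt 0" and fin: "qt \<le> qh" and or: "orientation ct ch"
  shows "searched ct ch vis q par qt"
proof -
  have "qh = qt" using sc fin by (simp add: scanning_def)
  have "vis (ct e) \<noteq> 0" if "e < m" "vis (ch e) \<noteq> 0" for e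
  proof -
    have "queue q qt vis" using sc by (simp add: scanning_def)
    then obtain i where "i < qt" "q i = ch e"
      using queue_visited[of q qt vis "ch e"] orientation_in_N[OF or \<open>e < m\<close>] \<open>vis (ch e) \<noteq> 0\<close> by blast
    then have "ch e \<in> q ` {..<qh}" using \<open>qh = qt\<close> by (metis imageI lessThan_iff)
    then show ?thesis using sc that unfolding scanning_def by blast
  qed
  then show ?thesis using sc by (simp add: scanning_def searched_def)
qed

lemma halts_reset:
  assumes "input_kept s"
  shows "halts reset_prog s (6 * m + 2) (\<lambda>s'. agree {7, 9, 15} s s' \<and> (\<forall>v\<in>N. s' 7 v = 0 \<and> s' 9 v = 0))"
proof -
  let ?I = "\<lambda>j s'. agree {7, 9, 15} s s' \<and>
    (\<forall>e<j. s' 7 (tail G e) = 0 \<and> s' 7 (head G e) = 0 \<and> s' 9 (tail G e) = 0 \<and> s' 9 (head G e) = 0)"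
  have "halts reset_prog s ((4 + 2) * m + 2) (?I m)"
    unfolding reset_prog_def
  proof (rule halts_for_arcs)
    fix j s' assume "?I j s'"
    then have "input_kept s'" by (auto intro: input_kept_agree[OF assms])
    then show "s' 0 1 = m" by (simp add: input_kept_def)
  next
    fix j s' assume I: "?I j s'" and j: "j < m" "s' 15 0 = j"
    then have "input_kept s'" by (auto intro: input_kept_agree[OF assms])
    then have "s' 1 j = tail G j" "s' 2 j = head G j" using j by (simp_all add: input_kept_def)
    then show "halts
        (Seq (Write 7 (Read 1 (var 15)) (Const 0)) (Seq (Write 7 (Read 2 (var 15)) (Const 0))
        (Seq (Write 9 (Read 1 (var 15)) (Const 0)) (Write 9 (Read 2 (var 15)) (Const 0)))))
        s' 4 (\<lambda>s'. s' 15 0 = j \<and> ?I (Suc j) (s'(15 := (s' 15)(0 := Suc j))))"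
      using I j by (auto simp: less_Suc_eq)
  next
    show "?I 0 (s(15 := (s 15)(0 := 0)))" by (simp del: fun_upd_apply)
  qed
  then show ?thesis by (rule halts_mono) (auto simp: N_def)
qed

definition target_queue :: "(nat \<Rightarrow> nat) \<Rightarrow> (nat \<Rightarrow> nat) \<Rightarrow> nat \<Rightarrow> bool" where
  "target_queue vis q n \<longleftrightarrow> queue q n vis \<and> (\<forall>v\<in>N. vis v \<noteq> 0 \<longrightarrow> v \<in> Y)"

text \<open>The expression is evaluated again after each write, so its value must survive changes of
  the written arrays.\<close>

lemma halts_enqueue_target:
  assumes s: "input_kept s" and tq: "target_queue (s 9) (s 10) (s 13 0)" and v: "v \<in> N"
    and z: "\<And>s'. agree {9, 10, 13} s s' \<Longrightarrow> eval_exp z s' = v"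
  shows "halts (enqueue_target z) s 4 (\<lambda>s'. agree {9, 10, 13} s s' \<and>
    target_queue (s' 9) (s' 10) (s' 13 0) \<and> (v \<in> Y \<longrightarrow> s' 9 v \<noteq> 0) \<and> (\<forall>x. s 9 x \<noteq> 0 \<longrightarrow> s' 9 x \<noteq> 0))"
proof (cases "v \<in> Y \<and> s 9 v = 0")
  case True
  then have "s 4 v \<noteq> 0" using s by (simp add: input_kept_def)
  moreover have "target_queue ((s 9)(v := Suc 0)) ((s 10)(s 13 0 := v)) (Suc (s 13 0))"
    using tq queue_add[of "s 10" "s 13 0" "s 9" v] v True by (auto simp: target_queue_def)
  ultimately show ?thesis
    using True by (simp add: enqueue_target_def enqueue_def z)
next
  case False
  then have "s 4 v = 0 \<or> s 9 v \<noteq> 0" using s by (auto simp: input_kept_def)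
  then show ?thesis
    using False tq by (auto simp: enqueue_target_def z)
qed

lemma halts_link:
  assumes s: "input_kept s" "orientation (s 5) (s 6)" and zero: "s 13 0 = 0" "\<And>v. v \<in> N \<Longrightarrow> s 7 v = 0 \<and> s 9 v = 0"
  shows "halts link_prog s (12 * m + 2) (\<lambda>s'. agree {7, 8, 9, 10, 13, 15} s s' \<and>
    linked (s 6) m (s' 7) (s' 8) \<and> scanning (s 5) (s 6) (s' 9) (s' 10) (s' 11) 0 (s' 13 0) 0)"
proof -
  let ?I = "\<lambda>j s'. agree {7, 8, 9, 10, 13, 15} s s' \<and> linked (s 6) j (s' 7) (s' 8) \<and>
    target_queue (s' 9) (s' 10) (s' 13 0) \<and>
    (\<forall>e<j. (tail G e \<in> Y \<longrightarrow> s' 9 (tail G e) \<noteq> 0) \<and> (head G e \<in> Y \<longrightarrow> s' 9 (head G e) \<noteq> 0))"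
  have "halts link_prog s ((10 + 2) * m + 2) (?I m)"
    unfolding link_prog_def
  proof (rule halts_for_arcs)
    show "?I 0 (s(15 := (s 15)(0 := 0)))"
      using zero by (auto simp: linked_def last_in_def target_queue_def queue_def)
  next
    fix j s' assume "?I j s'"
    then have "input_kept s'" by (auto intro: input_kept_agree[OF s(1)])
    then show "s' 0 1 = m" by (simp add: input_kept_def)
  next
    fix j s1 assume I: "?I j s1" and j: "j < m" "s1 15 0 = j"
    let ?Q = "\<lambda>s'. s' 15 0 = j \<and> ?I (Suc j) (s'(15 := (s' 15)(0 := Suc j)))"
    have k1: "input_kept s1" using I by (auto intro: input_kept_agree[OF s(1)])
    then have ends: "s1 1 j = tail G j" "s1 2 j = head G j" using j by (simp_all add: input_kept_def)
    have ch: "s1 6 = s 6" using I by (simp add: agree_def)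
    define s2 where "s2 = s1(8 := (s1 8)(j := s1 7 (s 6 j)), 7 := (s1 7)(s 6 j := Suc j))"
    have k2: "input_kept s2" using k1 by (simp add: input_kept_def s2_def)
    have l2: "linked (s 6) (Suc j) (s2 7) (s2 8)"
      using I linked_Suc[of "s 6" j "s1 7" "s1 8"] orientation_in_N[OF s(2) j(1)] by (simp add: s2_def)
    have e2: "agree {9, 10, 13} s2 s' \<Longrightarrow> eval_exp (Read 1 (var 15)) s' = tail G j"
      "agree {9, 10, 13} s2 s' \<Longrightarrow> eval_exp (Read 2 (var 15)) s' = head G j" for s'
      using j ends by (simp_all add: agree_def s2_def)
    have "halts (Seq (enqueue_target (Read 1 (var 15))) (enqueue_target (Read 2 (var 15)))) s2 8 ?Q"
    proof (rule halts_Seq)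
      have "target_queue (s2 9) (s2 10) (s2 13 0)" using I by (simp add: s2_def)
      from halts_enqueue_target[OF k2 this _ e2(1)]
      show "halts (enqueue_target (Read 1 (var 15))) s2 4
        (\<lambda>s'. halts (enqueue_target (Read 2 (var 15))) s' 4 ?Q)"
      proof (rule halts_mono)
        fix s3 assume s3: "agree {9, 10, 13} s2 s3 \<and> target_queue (s3 9) (s3 10) (s3 13 0) \<and>
          (tail G j \<in> Y \<longrightarrow> s3 9 (tail G j) \<noteq> 0) \<and> (\<forall>x. s2 9 x \<noteq> 0 \<longrightarrow> s3 9 x \<noteq> 0)"
        have k3: "input_kept s3" using s3 by (auto intro: input_kept_agree[OF k2])
        have e3: "agree {9, 10, 13} s3 s' \<Longrightarrow> eval_exp (Read 2 (var 15)) s' = head G j" for s'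
          using s3 by (intro e2(2)) (auto elim: agree_trans)
        from halts_enqueue_target[OF k3 _ _ e3] s3 j
        have "halts (enqueue_target (Read 2 (var 15))) s3 4 (\<lambda>s'. agree {9, 10, 13} s3 s' \<and>
          target_queue (s' 9) (s' 10) (s' 13 0) \<and> (head G j \<in> Y \<longrightarrow> s' 9 (head G j) \<noteq> 0) \<and>
          (\<forall>x. s3 9 x \<noteq> 0 \<longrightarrow> s' 9 x \<noteq> 0))" by simp
        then show "halts (enqueue_target (Read 2 (var 15))) s3 4 ?Q"
        proof (rule halts_mono)
          fix s' assume s': "agree {9, 10, 13} s3 s' \<and>
            target_queue (s' 9) (s' 10) (s' 13 0) \<and> (head G j \<in> Y \<longrightarrow> s' 9 (head G j) \<noteq> 0) \<and>
            (\<forall>x. s3 9 x \<noteq> 0 \<longrightarrow> s' 9 x \<noteq> 0)"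
          have a: "agree {9, 10, 13} s2 s'" using s3 s' by (auto elim: agree_trans)
          have "agree {7, 8} s1 s2" by (simp add: s2_def)
          then have "agree {7, 8, 9, 10, 13, 15} s1 s'" by (rule agree_trans[OF _ a]) auto
          then have "agree {7, 8, 9, 10, 13, 15} s s'" using I by (auto elim: agree_trans)
          moreover have "s' 7 = s2 7" "s' 8 = s2 8" "s' 15 = s2 15" using a by (simp_all add: agree_def)
          moreover have "\<forall>x. s1 9 x \<noteq> 0 \<longrightarrow> s' 9 x \<noteq> 0" using s3 s' by (simp add: s2_def)
          moreover have "tail G j \<in> Y \<longrightarrow> s' 9 (tail G j) \<noteq> 0" using s3 s' by blast
          ultimately show "?Q s'"
            using I s' l2 j by (auto simp: less_Suc_eq s2_def)
        qed simp
      qed (use j in simp_all)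
    qed simp
    moreover have "s1(8 := (s1 8)(j := s1 7 (s 6 j)),
        7 := ((s1(8 := (s1 8)(j := s1 7 (s 6 j)))) 7)(s 6 j := Suc j)) = s2"
      by (simp add: s2_def)
    ultimately show "halts
        (Seq (Write 8 (var 15) (Read 7 (Read 6 (var 15)))) (Seq (Write 7 (Read 6 (var 15)) (Inc (var 15)))
        (Seq (enqueue_target (Read 1 (var 15))) (enqueue_target (Read 2 (var 15)))))) s1 10 ?Q"
      by (simp add: j ch s2_def)
  qed
  then show ?thesis
  proof (rule halts_mono)
    fix s' assume I: "?I m s'"
    then have "\<forall>v\<in>N \<inter> Y. s' 9 v \<noteq> 0" by (auto simp: N_def)
    moreover have "parents (s 5) (s 6) (s' 10) (s' 11) (s' 13 0)"
      using I queueD[of "s' 10" "s' 13 0" "s' 9"] by (auto simp: parents_def target_queue_def)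
    ultimately show "agree {7, 8, 9, 10, 13, 15} s s' \<and>
      linked (s 6) m (s' 7) (s' 8) \<and> scanning (s 5) (s 6) (s' 9) (s' 10) (s' 11) 0 (s' 13 0) 0"
      using I by (simp add: scanning_def target_queue_def)
  qed simp
qed

lemma halts_scan:
  assumes or: "orientation (s 5) (s 6)" and lk: "linked (s 6) m (s 7) (s 8)"
    and sc: "scanning (s 5) (s 6) (s 9) (s 10) (s 11) 0 (s 13 0) 0" and zero: "s 12 0 = 0" "s 14 0 = 0"
  shows "halts scan_prog s (24 * m + 1) (\<lambda>s'. agree {9, 10, 11, 12, 13, 14} s s' \<and>
    searched (s 5) (s 6) (s' 9) (s' 10) (s' 11) (s' 13 0))"
proof -
  let ?I = "\<lambda>n s'. agree {9, 10, 11, 12, 13, 14} s s' \<and>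
    scanning (s 5) (s 6) (s' 9) (s' 10) (s' 11) (s' 12 0) (s' 13 0) (s' 14 0) \<and>
    n = 8 * scan_potential (s 6) (s' 10) (s' 12 0) (s' 14 0)"
  \<comment> \<open>An iteration takes at most 7 steps plus the loop test, hence the factor 8; the
    initial potential is at most \<open>card N + m\<close>, thus at most
    \<open>3 * m\<close>.\<close>
  let ?n = "8 * scan_potential (s 6) (s 10) 0 0"
  have "halts scan_prog s (?n + 1) (\<lambda>s'. (\<exists>n'. ?I n' s') \<and>
      \<not> eval_test (Neg (Conj (Equal (var 14) (Const 0)) (Neg (Less (var 12) (var 13))))) s')"
    unfolding scan_prog_def
  proof (rule halts_Loop)
    show "?I ?n s" using sc zero by simp
  next
    fix n s1 assume I: "?I n s1"
      and test: "eval_test (Neg (Conj (Equal (var 14) (Const 0)) (Neg (Less (var 12) (var 13))))) s1"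
    then have arr: "s1 5 = s 5" "s1 6 = s 6" "s1 7 = s 7" "s1 8 = s 8" by (simp_all add: agree_def)
    have "halts (Cond (Equal (var 14) (Const 0))
        (Seq (set_var 14 (Read 7 (Read 10 (var 12)))) (set_var 12 (Inc (var 12))))
        (Seq (Cond (Equal (Read 9 (Read 5 (Dec (var 14)))) (Const 0))
               (Seq (Write 11 (Read 5 (Dec (var 14))) (Dec (var 14))) (enqueue (Read 5 (Dec (var 14))))) Nop)
             (set_var 14 (Read 8 (Dec (var 14)))))) s1 7 (\<lambda>s'. \<exists>n'. ?I n' s' \<and> n' + 7 + 1 \<le> n)"
    proof (cases "s1 14 0 = 0")
      case True
      then have "s1 12 0 < s1 13 0" using test by simp
      then show ?thesis
        using True I scanning_dequeue[of "s 5" "s 6" "s1 9" "s1 10" "s1 11" "s1 12 0" "s1 13 0" "s 7" "s 8"] lk arr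
        by simp
    next
      case False
      let ?u = "s 5 (s1 14 0 - 1)"
      note adv = scanning_advance[where ct = "s 5" and ch = "s 6" and a = "s1 14 0" and qh = "s1 12 0", OF _ _ lk]
      show ?thesis
      proof (cases "s1 9 ?u = 0")
        case True
        note vis = scanning_visit[of "s 5" "s 6" "s1 9" "s1 10" "s1 11" "s1 12 0" "s1 13 0" "s1 14 0", OF _ _ or]
        show ?thesis
          using True False I vis adv[of "(s1 9)(?u := Suc 0)" "(s1 10)(s1 13 0 := ?u)"
              "(s1 11)(?u := s1 14 0 - 1)" "Suc (s1 13 0)"] arr
          by (simp add: enqueue_def)
      next
        case ne: False
        then show ?thesis
          using False I adv[of "s1 9" "s1 10" "s1 11" "s1 13 0"] arr by simp
      qed
    qed
    then show "\<exists>c. halts (Cond (Equal (var 14) (Const 0))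
        (Seq (set_var 14 (Read 7 (Read 10 (var 12)))) (set_var 12 (Inc (var 12))))
        (Seq (Cond (Equal (Read 9 (Read 5 (Dec (var 14)))) (Const 0))
               (Seq (Write 11 (Read 5 (Dec (var 14))) (Dec (var 14))) (enqueue (Read 5 (Dec (var 14))))) Nop)
             (set_var 14 (Read 8 (Dec (var 14)))))) s1 c (\<lambda>s'. \<exists>n'. ?I n' s' \<and> n' + c + 1 \<le> n)"
      by blast
  qed
  then show ?thesis
  proof (rule halts_mono)
    show "?n + 1 \<le> 24 * m + 1"
      using card_N by (simp add: scan_potential_def)
  next
    fix s' assume "(\<exists>n'. ?I n' s') \<and>
      \<not> eval_test (Neg (Conj (Equal (var 14) (Const 0)) (Neg (Less (var 12) (var 13))))) s'"
    then show "agree {9, 10, 11, 12, 13, 14} s s' \<and>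
        searched (s 5) (s 6) (s' 9) (s' 10) (s' 11) (s' 13 0)"
      using scanning_end[OF _ _ or, of "s' 9" "s' 10" "s' 11" "s' 12 0" "s' 13 0"] by auto
  qed
qed

definition search_done :: "store \<Rightarrow> bool" where
  "search_done s \<longleftrightarrow> searched (s 5) (s 6) (s 9) (s 10) (s 11) (s 13 0)"

lemma halts_search:
  assumes s: "input_kept s" "orientation (s 5) (s 6)"
  shows "halts search_prog s (42 * m + 8) (\<lambda>s'. agree {7, 8, 9, 10, 11, 12, 13, 14, 15} s s' \<and> search_done s')"
  (is "halts _ _ _ ?Q")
proof -
  let ?D = "{7, 8, 9, 10, 11, 12, 13, 14, 15} :: nat set"
  have "halts reset_prog s (6 * m + 2) (\<lambda>s1. halts (Seq (set_var 12 (Const 0)) (Seq (set_var 13 (Const 0))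
     (Seq (set_var 14 (Const 0)) (Seq link_prog scan_prog)))) s1 (36 * m + 6) ?Q)"
    using halts_reset[OF s(1)]
  proof (rule halts_mono)
    fix s1 assume s1: "agree {7, 9, 15} s s1 \<and> (\<forall>v\<in>N. s1 7 v = 0 \<and> s1 9 v = 0)"
    define s2 where "s2 = s1(12 := (s1 12)(0 := 0), 13 := (s1 13)(0 := 0), 14 := (s1 14)(0 := 0))"
    have a2: "agree ?D s s2" using s1 by (auto simp: s2_def agree_def)
    then have k2: "input_kept s2" by (auto intro: input_kept_agree[OF s(1)])
    have o2: "orientation (s2 5) (s2 6)" using a2 s(2) by (simp add: agree_def)
    have "halts link_prog s2 (12 * m + 2) (\<lambda>s'. agree {7, 8, 9, 10, 13, 15} s2 s' \<and>
      linked (s2 6) m (s' 7) (s' 8) \<and> scanning (s2 5) (s2 6) (s' 9) (s' 10) (s' 11) 0 (s' 13 0) 0)"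
      using s1 by (intro halts_link k2 o2) (simp_all add: s2_def)
    then have "halts link_prog s2 (12 * m + 2) (\<lambda>s3. halts scan_prog s3 (24 * m + 1) ?Q)"
    proof (rule halts_mono)
      fix s3 assume s3: "agree {7, 8, 9, 10, 13, 15} s2 s3 \<and>
        linked (s2 6) m (s3 7) (s3 8) \<and> scanning (s2 5) (s2 6) (s3 9) (s3 10) (s3 11) 0 (s3 13 0) 0"
      then have arr: "s3 5 = s2 5" "s3 6 = s2 6" "s3 12 = s2 12" "s3 14 = s2 14" by (simp_all add: agree_def)
      have "halts scan_prog s3 (24 * m + 1) (\<lambda>s'. agree {9, 10, 11, 12, 13, 14} s3 s' \<and>
        searched (s3 5) (s3 6) (s' 9) (s' 10) (s' 11) (s' 13 0))"
        using s3 o2 unfolding arr[symmetric] by (intro halts_scan) (simp_all add: arr s2_def)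
      then show "halts scan_prog s3 (24 * m + 1) ?Q"
      proof (rule halts_mono)
        fix s' assume s': "agree {9, 10, 11, 12, 13, 14} s3 s' \<and>
          searched (s3 5) (s3 6) (s' 9) (s' 10) (s' 11) (s' 13 0)"
        then have "s' 5 = s3 5" "s' 6 = s3 6" by (simp_all add: agree_def)
        moreover have "agree ?D s2 s3" using s3 by (auto simp: agree_def)
        then have "agree ?D s2 s'" using s' by (auto simp: agree_def)
        then have "agree ?D s s'" using a2 by (auto simp: agree_def)
        ultimately show "?Q s'" using s' by (simp add: search_done_def)
      qed simp
    qed simp
    then have "halts (Seq link_prog scan_prog) s2 (36 * m + 3) ?Q"
      by (rule halts_Seq) simp
    then show "halts (Seq (set_var 12 (Const 0)) (Seq (set_var 13 (Const 0))
     (Seq (set_var 14 (Const 0)) (Seq link_prog scan_prog)))) s1 (36 * m + 6) ?Q"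
      by (simp add: s2_def numeral_eq_Suc)
  qed simp
  then show ?thesis unfolding search_prog_def by (rule halts_Seq) simp
qed

subsection \<open>Pushing\<close>

lemma cut_size_flip:
  assumes "e < m"
  shows "int (cut_size (arcs G) (ct(e := ch e)) (ch(e := ct e)) S)
       = int (cut_size (arcs G) ct ch S) + of_bool (ch e \<in> S) - of_bool (ct e \<in> S)"
proof -
  have "ct(e := ch e) = (\<lambda>x. if x \<in> {e} then ch x else ct x)"
    "ch(e := ct e) = (\<lambda>x. if x \<in> {e} then ct x else ch x)" by auto
  then show ?thesis
    using cut_size_reverse[OF finite_arcs, of "{e}" ch ct S] assms by simp
qed

lemma orientation_flip: "orientation ct ch \<Longrightarrow> orientation (ct(e := ch e)) (ch(e := ct e))"
  by (auto simp: orientation_def)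

text \<open>The reversed arc has tail \<open>q i\<close>, whereas parent arcs of earlier vertices
  have other tails; so the forest below position \<open>i\<close> is intact.\<close>

lemma parents_flip:
  assumes q: "queue q n vis" and par: "parents ct ch q par (Suc i)" and i: "i < n" "l < i"
    and e: "ct e = q i"
  shows "parents (ct(e := ch e)) (ch(e := ct e)) q par (Suc l)"
  unfolding parents_def
proof (intro allI impI)
  fix j assume j: "j < Suc l" "q j \<notin> Y"
  then have "j < Suc i" using i by simp
  then have *: "par (q j) < m \<and> ct (par (q j)) = q j \<and> (\<exists>l<j. ch (par (q j)) = q l)"
    using par j unfolding parents_def by blast
  have "q j \<noteq> q i" using queue_nth_eq[OF q, of j i] i j by auto
  then have "par (q j) \<noteq> e" using * e by metis
  then show "par (q j) < m \<and> (ct(e := ch e)) (par (q j)) = q j \<and> (\<exists>l<j. (ch(e := ct e)) (par (q j)) = q l)"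
    using * by simp
qed

text \<open>Reversing one arc at a time keeps the cut changes equal to the indicator of the current
  vertex minus that of \<open>v\<close>; the former vanishes once \<open>Y\<close> is reached. Queue
  positions decrease, and each iteration costs 4 writes and a test.\<close>

lemma halts_push:
  assumes s: "input_kept s" "orientation (s 5) (s 6)" "search_done s"
    and v: "s 18 0 = v" "v \<in> N" "s 9 v \<noteq> 0"
  shows "halts push_prog s (10 * m + 1) (\<lambda>s'. agree {5, 6, 18, 19} s s' \<and> orientation (s' 5) (s' 6) \<and>
    (\<forall>S. S \<subseteq> verts G - Y \<longrightarrow> int (cut_size (arcs G) (s' 5) (s' 6) S)
       = int (cut_size (arcs G) (s 5) (s 6) S) - of_bool (v \<in> S)))"
proof -
  let ?n = "s 13 0"
  have q: "queue (s 10) ?n (s 9)" and par: "parents (s 5) (s 6) (s 10) (s 11) ?n"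
    using s(3) by (simp_all add: search_done_def searched_def)
  let ?I = "\<lambda>n s'. agree {5, 6, 18, 19} s s' \<and> orientation (s' 5) (s' 6) \<and>
    (\<exists>i<?n. s' 18 0 = s 10 i \<and> n = 5 * i \<and> parents (s' 5) (s' 6) (s 10) (s 11) (Suc i)) \<and>
    (\<forall>S. int (cut_size (arcs G) (s' 5) (s' 6) S)
       = int (cut_size (arcs G) (s 5) (s 6) S) + of_bool (s' 18 0 \<in> S) - of_bool (v \<in> S))"
  obtain i\<^sub>0 where i0: "i\<^sub>0 < ?n" "s 10 i\<^sub>0 = v" using queue_visited[OF q v(2,3)] by blast
  have "halts push_prog s (5 * i\<^sub>0 + 1) (\<lambda>s'. (\<exists>n'. ?I n' s') \<and> \<not> eval_test (Equal (Read 4 (var 18)) (Const 0)) s')"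
    unfolding push_prog_def
  proof (rule halts_Loop)
    have "parents (s 5) (s 6) (s 10) (s 11) (Suc i\<^sub>0)"
      using par i0 unfolding parents_def by auto
    then show "?I (5 * i\<^sub>0) s" using i0 v s(2) by auto
  next
    fix n s1 assume I: "?I n s1" and test: "eval_test (Equal (Read 4 (var 18)) (Const 0)) s1"
    then obtain i where i: "i < ?n" "s1 18 0 = s 10 i" "n = 5 * i"
      "parents (s1 5) (s1 6) (s 10) (s 11) (Suc i)" by blast
    have arr: "s1 4 = s 4" "s1 11 = s 11" using I by (simp_all add: agree_def)
    have "s 4 (s 10 i) = 0" using test i by (simp add: arr)
    then have "s 10 i \<notin> Y" using s(1) by (metis input_kept_def)
    then obtain l where l: "s 11 (s 10 i) < m" "s1 5 (s 11 (s 10 i)) = s 10 i" "l < i"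
      "s1 6 (s 11 (s 10 i)) = s 10 l"
      using i(4) unfolding parents_def by blast
    let ?e = "s 11 (s 10 i)"
    let ?ct = "(s1 5)(?e := s1 6 ?e)" and ?ch = "(s1 6)(?e := s1 5 ?e)"
    have "parents ?ct ?ch (s 10) (s 11) (Suc l)"
      by (rule parents_flip[OF q i(4) i(1) l(3) l(2)])
    moreover have "orientation ?ct ?ch" using I by (intro orientation_flip) blast
    moreover have "int (cut_size (arcs G) ?ct ?ch S)
       = int (cut_size (arcs G) (s 5) (s 6) S) + of_bool (s 10 l \<in> S) - of_bool (v \<in> S)" for S
      using I i l cut_size_flip[OF l(1), of "s1 5" "s1 6" S] by simp
    moreover define s2 where
      "s2 = s1(19 := (s1 19)(0 := ?e), 18 := (s1 18)(0 := s1 6 ?e), 6 := ?ch, 5 := ?ct)"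
    moreover have "s2 5 = ?ct" "s2 6 = ?ch" "s2 18 0 = s 10 l" using l by (simp_all add: s2_def)
    moreover have "agree {5, 6, 18, 19} s s2" using I by (simp add: s2_def del: fun_upd_apply)
    moreover have "l < ?n" using i l by simp
    ultimately have "?I (5 * l) s2" by (simp only:) blast
    moreover have "5 * l + 4 + 1 \<le> n" using i l by simp
    moreover have "halts (Seq (set_var 19 (Read 11 (var 18))) (Seq (set_var 18 (Read 6 (var 19)))
     (Seq (Write 6 (var 19) (Read 5 (var 19))) (Write 5 (var 19) (var 18))))) s1 4 (\<lambda>s'. s' = s2)"
      using i l arr by (simp add: s2_def fun_upd_def)
    ultimately have "halts (Seq (set_var 19 (Read 11 (var 18))) (Seq (set_var 18 (Read 6 (var 19)))
     (Seq (Write 6 (var 19) (Read 5 (var 19))) (Write 5 (var 19) (var 18))))) s1 4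
     (\<lambda>s'. \<exists>n'. ?I n' s' \<and> n' + 4 + 1 \<le> n)"
      by (elim halts_mono) blast+
    then show "\<exists>c. halts (Seq (set_var 19 (Read 11 (var 18))) (Seq (set_var 18 (Read 6 (var 19)))
     (Seq (Write 6 (var 19) (Read 5 (var 19))) (Write 5 (var 19) (var 18))))) s1 c
     (\<lambda>s'. \<exists>n'. ?I n' s' \<and> n' + c + 1 \<le> n)" by blast
  qed
  then show ?thesis
  proof (rule halts_mono)
    show "5 * i\<^sub>0 + 1 \<le> 10 * m + 1" using i0 queue_le[OF q] card_N by simp
  next
    fix s' assume s': "(\<exists>n'. ?I n' s') \<and> \<not> eval_test (Equal (Read 4 (var 18)) (Const 0)) s'"
    then have "s' 4 = s 4" by (simp add: agree_def)
    moreover from this have "s 4 (s' 18 0) \<noteq> 0" using s' by simp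
    ultimately have "s' 18 0 \<in> Y" using s(1) by (metis input_kept_def)
    then show "agree {5, 6, 18, 19} s s' \<and> orientation (s' 5) (s' 6) \<and>
      (\<forall>S. S \<subseteq> verts G - Y \<longrightarrow> int (cut_size (arcs G) (s' 5) (s' 6) S)
         = int (cut_size (arcs G) (s 5) (s 6) S) - of_bool (v \<in> S))"
      using s' by auto
  qed
qed

text \<open>Vertices without incident arcs are never visited; those outside \<open>Y\<close> belong to \<open>T\<close>.\<close>

definition synced :: "nat multiset \<Rightarrow> nat set \<Rightarrow> store \<Rightarrow> bool" where
  "synced M T s \<longleftrightarrow> input_kept s \<and> orientation (s 5) (s 6) \<and> search_done s \<and>
     (\<forall>S. S \<subseteq> verts G - Y \<longrightarrow> int (cut_size (arcs G) (s 5) (s 6) S) = residual M S) \<and>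
     T = {v \<in> verts G - Y. v \<in> N \<longrightarrow> s 9 v = 0}"

lemma synced_visited_iff:
  assumes "synced M T s" "v \<in> N"
  shows "s 9 v = 0 \<longleftrightarrow> v \<in> T"
proof -
  have "T = {v \<in> verts G - Y. v \<in> N \<longrightarrow> s 9 v = 0}" "\<forall>v\<in>N \<inter> Y. s 9 v \<noteq> 0"
    using assms(1) unfolding synced_def search_done_def searched_def by blast+
  then show ?thesis using assms(2) N_verts by blast
qed

text \<open>No arc leaves the unvisited part, so \<open>T\<close> is tight. A larger set contains a
  visited vertex; the parent arc of the earliest one in the queue leads to an earlier vertex and
  therefore leaves the set.\<close>

lemma synced_greatest_tight:
  assumes s: "synced M T s"
  shows "greatest_tight M T"
proof -
  have or: "orientation (s 5) (s 6)" and sd: "searched (s 5) (s 6) (s 9) (s 10) (s 11) (s 13 0)"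
    and res: "\<And>S. S \<subseteq> verts G - Y \<Longrightarrow> residual M S = int (cut_size (arcs G) (s 5) (s 6) S)"
    and TV: "T \<subseteq> verts G - Y"
    using s unfolding synced_def search_done_def by (blast, blast, metis, blast)
  have closed: "s 6 e \<in> T" if "e < m" "s 5 e \<in> T" for e
  proof -
    have "s 9 (s 5 e) = 0"
      using synced_visited_iff[OF s orientation_in_N(1)[OF or \<open>e < m\<close>]] that by simp
    then have "s 9 (s 6 e) = 0" using sd that(1) unfolding searched_def by fastforce
    then show ?thesis
      using synced_visited_iff[OF s orientation_in_N(2)[OF or \<open>e < m\<close>]] by simp
  qed
  have "cut_size (arcs G) (s 5) (s 6) T = 0"
    using closed by (auto simp: cut_size_def)
  then have "residual M T = 0" using res[OF TV] by simp
  moreover have "0 < residual M S" if S: "S \<subseteq> verts G - Y" "T \<subset> S" for S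
  proof -
    obtain v where v: "v \<in> S" "v \<notin> T" using S by blast
    have q: "queue (s 10) (s 13 0) (s 9)" and par: "parents (s 5) (s 6) (s 10) (s 11) (s 13 0)"
      using sd by (simp_all add: searched_def)
    have "v \<in> N \<and> s 9 v \<noteq> 0" using s S v by (auto simp: synced_def)
    then have ex: "\<exists>i. i < s 13 0 \<and> s 10 i \<in> S" using queue_visited[OF q] v by metis
    define i where "i = (LEAST i. i < s 13 0 \<and> s 10 i \<in> S)"
    have i: "i < s 13 0" "s 10 i \<in> S" using LeastI_ex[OF ex] by (simp_all add: i_def)
    have least: "s 10 j \<notin> S" if "j < i" for j
      using not_less_Least[of j "\<lambda>i. i < s 13 0 \<and> s 10 i \<in> S"] that i(1) unfolding i_def by auto
    have "s 10 i \<notin> Y" using i S by auto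
    then obtain j where j: "s 11 (s 10 i) < m" "s 5 (s 11 (s 10 i)) = s 10 i" "j < i"
      "s 6 (s 11 (s 10 i)) = s 10 j" using par i unfolding parents_def by blast
    then have "s 11 (s 10 i) \<in> {e \<in> arcs G. s 5 e \<in> S \<and> s 6 e \<notin> S}"
      using i least[OF j(3)] by simp
    then have "0 < cut_size (arcs G) (s 5) (s 6) S"
      unfolding cut_size_def by (intro card_gt_0_iff[THEN iffD2]) auto
    then show ?thesis using res S by simp
  qed
  ultimately show ?thesis using TV res by (simp add: greatest_tight_def)
qed

lemma halts_push_search:
  assumes s: "synced M T s" and v: "s 18 0 = v" "v \<in> N" "v \<notin> T"
  shows "halts (Seq push_prog search_prog) s (52 * m + 9)
    (\<lambda>s'. agree ({5..15} \<union> {18, 19}) s s' \<and> (\<exists>T'. synced (add_mset v M) T' s'))"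
    (is "halts _ _ _ ?Q")
proof (rule halts_Seq)
  have k: "input_kept s" using s by (simp add: synced_def)
  have "s 9 v \<noteq> 0" using synced_visited_iff[OF s v(2)] v(3) by simp
  with s v(1,2) have "halts push_prog s (10 * m + 1) (\<lambda>s'. agree {5, 6, 18, 19} s s' \<and> orientation (s' 5) (s' 6) \<and>
    (\<forall>S. S \<subseteq> verts G - Y \<longrightarrow> int (cut_size (arcs G) (s' 5) (s' 6) S)
       = int (cut_size (arcs G) (s 5) (s 6) S) - of_bool (v \<in> S)))"
    by (intro halts_push) (simp_all add: synced_def)
  then show "halts push_prog s (10 * m + 1) (\<lambda>s1. halts search_prog s1 (42 * m + 8) ?Q)"
  proof (rule halts_mono)
    fix s1 assume s1: "agree {5, 6, 18, 19} s s1 \<and> orientation (s1 5) (s1 6) \<and>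
      (\<forall>S. S \<subseteq> verts G - Y \<longrightarrow> int (cut_size (arcs G) (s1 5) (s1 6) S)
         = int (cut_size (arcs G) (s 5) (s 6) S) - of_bool (v \<in> S))"
    then have k1: "input_kept s1" using input_kept_agree[OF k, of "{5, 6, 18, 19}" s1] by simp
    have "halts search_prog s1 (42 * m + 8) (\<lambda>s'. agree {7, 8, 9, 10, 11, 12, 13, 14, 15} s1 s' \<and> search_done s')"
      using s1 by (intro halts_search k1) simp
    then show "halts search_prog s1 (42 * m + 8) ?Q"
    proof (rule halts_mono)
      fix s' assume s': "agree {7, 8, 9, 10, 11, 12, 13, 14, 15} s1 s' \<and> search_done s'"
      then have "input_kept s'"
        using input_kept_agree[OF k1, of "{7, 8, 9, 10, 11, 12, 13, 14, 15}" s'] by simp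
      moreover have "s' 5 = s1 5" "s' 6 = s1 6" using s' by (simp_all add: agree_def)
      ultimately have "synced (add_mset v M) {v \<in> verts G - Y. v \<in> N \<longrightarrow> s' 9 v = 0} s'"
        using s s1 s' by (simp add: synced_def residual_add)
      moreover have "agree ({5..15} \<union> {18, 19}) s s'"
        using s1 s' by (auto simp: agree_def)
      ultimately show "?Q s'" by blast
    qed simp
  qed simp
qed simp

subsection \<open>Executing the phases\<close>

text \<open>Common analysis of both kinds of phase, with an abstract invariant \<open>P\<close>. The
  potential reserves 4 steps for each remaining arc and \<open>60 * (m + 1)\<close> for each of the
  at most \<open>B\<close> pushes.\<close>

lemma halts_phase_prog:
  assumes s: "synced M\<^sub>0 T\<^sub>0 s" and U: "\<And>e. e < m \<Longrightarrow> s 3 (tail G e) \<noteq> 0 \<longleftrightarrow> tail G e \<in> U"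
    and f: "a = 1 \<and> f = tail G \<or> a = 2 \<and> f = head G"
    and start: "P 0 M\<^sub>0 T\<^sub>0"
    and skip: "\<And>j M T. P j M T \<Longrightarrow> j < m \<Longrightarrow> tail G j \<notin> U \<or> f j \<in> T \<Longrightarrow> P (Suc j) M T"
    and push: "\<And>j M T T'. P j M T \<Longrightarrow> j < m \<Longrightarrow> greatest_tight M T \<Longrightarrow> tail G j \<in> U \<Longrightarrow> f j \<notin> T \<Longrightarrow>
      greatest_tight (add_mset (f j) M) T' \<Longrightarrow> P (Suc j) (add_mset (f j) M) T'"
    and bound: "\<And>j M T. P j M T \<Longrightarrow> greatest_tight M T \<Longrightarrow> size M \<le> size M\<^sub>0 + B"
  shows "halts (phase_prog a) s (4 * m + 60 * (m + 1) * B + 2)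
    (\<lambda>s'. agree ({5..16} \<union> {18, 19}) s s' \<and> (\<exists>M T. synced M T s' \<and> P m M T))"
proof -
  let ?D = "{5..16} \<union> {18, 19} :: nat set"
  let ?I = "\<lambda>j n s'. agree ?D s s' \<and> (\<exists>M T. synced M T s' \<and> P j M T \<and>
    n = 4 * (m - j) + 60 * (m + 1) * (size M\<^sub>0 + B - size M))"
  have upd: "synced M T (s'(16 := x)) = synced M T s'" for M T s' x
    by (simp add: synced_def input_kept_def search_done_def)
  have "halts (phase_prog a) s (4 * m + 60 * (m + 1) * B + 2) (\<lambda>s'. \<exists>n'. ?I m n' s')"
    unfolding phase_prog_def
  proof (rule halts_for_arcs_potential[where I = ?I])
    show "?I 0 (4 * m + 60 * (m + 1) * B) (s(16 := (s 16)(0 := 0)))"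
      using s start by (auto simp: upd simp del: fun_upd_apply intro!: exI[of _ M\<^sub>0] exI[of _ T\<^sub>0])
  next
    fix j n s' assume "?I j n s'"
    then show "s' 0 1 = m" by (auto simp: synced_def input_kept_def)
  next
    fix j n s1 assume I: "?I j n s1" and j: "j < m" "s1 16 0 = j"
    then obtain M T where M: "synced M T s1" "P j M T"
      and n: "n = 4 * (m - j) + 60 * (m + 1) * (size M\<^sub>0 + B - size M)" by blast
    have gt: "greatest_tight M T" using synced_greatest_tight[OF M(1)] .
    have "s1 3 = s 3" using I by (simp add: agree_def)
    moreover have kept: "s1 1 j = tail G j" "s1 2 j = head G j" using M(1) j by (simp_all add: synced_def input_kept_def)
    ultimately have tU: "s1 3 (s1 1 j) \<noteq> 0 \<longleftrightarrow> tail G j \<in> U" using U j by simp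
    have fj: "s1 a j = f j" using f kept by auto
    have fN: "f j \<in> N" using f j by auto
    then have fT: "s1 9 (s1 a j) \<noteq> 0 \<longleftrightarrow> f j \<notin> T" using fj synced_visited_iff[OF M(1)] by simp
    have a: "a \<noteq> 18" "a \<noteq> 16" using f by auto
    let ?body = "Cond (Conj (Neg (Equal (Read 3 (Read 1 (var 16))) (Const 0)))
                 (Neg (Equal (Read 9 (Read a (var 16))) (Const 0))))
        (Seq (set_var 18 (Read a (var 16))) (Seq push_prog search_prog)) Nop"
    let ?Q = "\<lambda>c s'. s' 16 0 = j \<and> (\<exists>n'. ?I (Suc j) n' (s'(16 := (s' 16)(0 := Suc j))) \<and> n' + c + 2 \<le> n)"
    have m4: "4 * (m - j) = 4 * (m - Suc j) + 4" using j by simp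
    show "\<exists>c. halts ?body s1 c (?Q c)"
    proof (cases "tail G j \<in> U \<and> f j \<notin> T")
      case False
      then have "P (Suc j) M T" using skip[OF M(2) j(1)] by blast
      moreover have "agree ?D s (s1(16 := (s1 16)(0 := Suc j)))" using I by (simp del: fun_upd_apply)
      moreover have "synced M T (s1(16 := (s1 16)(0 := Suc j)))" using M(1) by (simp only: upd)
      moreover have "4 * (m - Suc j) + 60 * (m + 1) * (size M\<^sub>0 + B - size M) + 2 + 2 \<le> n"
        using n m4 by simp
      ultimately have "?Q 2 s1" using j by blast
      moreover have "\<not> eval_test (Conj (Neg (Equal (Read 3 (Read 1 (var 16))) (Const 0)))
                 (Neg (Equal (Read 9 (Read a (var 16))) (Const 0)))) s1"
        using False tU fT j by auto
      ultimately have "halts ?body s1 2 (?Q 2)"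
        by (simp only: halts_Cond if_False halts_Nop) simp
      then show ?thesis by blast
    next
      case True
      define s2 where "s2 = s1(18 := (s1 18)(0 := f j))"
      have s2: "synced M T s2" using M(1) by (simp add: s2_def synced_def input_kept_def search_done_def)
      have "halts (Seq push_prog search_prog) s2 (52 * m + 9)
        (\<lambda>s'. agree ({5..15} \<union> {18, 19}) s2 s' \<and> (\<exists>T'. synced (add_mset (f j) M) T' s'))"
        using True fN by (intro halts_push_search[OF s2]) (simp_all add: s2_def)
      then have "halts (Seq push_prog search_prog) s2 (52 * m + 9) (?Q (52 * m + 11))"
      proof (rule halts_mono)
        fix s' assume s': "agree ({5..15} \<union> {18, 19}) s2 s' \<and> (\<exists>T'. synced (add_mset (f j) M) T' s')"
        then obtain T' where T': "synced (add_mset (f j) M) T' s'" by blast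
        note gt' = synced_greatest_tight[OF T']
        have P': "P (Suc j) (add_mset (f j) M) T'"
          using push[OF M(2) j(1) gt _ _ gt'] True by blast
        have "agree ?D s s2" using I by (auto simp: s2_def agree_def)
        moreover have "agree ?D s2 s'" using s' by (auto simp: agree_def)
        ultimately have "agree ?D s s'" by (rule agree_trans) simp_all
        then have ag: "agree ?D s (s'(16 := (s' 16)(0 := Suc j)))" by (simp del: fun_upd_apply)
        have "s' 16 = s2 16" using s' by (simp add: agree_def)
        then have j': "s' 16 0 = j" using j by (simp add: s2_def)
        \<comment> \<open>Applying the bound after the push ensures that the truncated difference in
          the potential really falls by 1.\<close>
        have "size M + 1 \<le> size M\<^sub>0 + B" using bound[OF P' gt'] by simp
        then have "size M\<^sub>0 + B - size M = Suc (size M\<^sub>0 + B - size (add_mset (f j) M))" by simp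
        then have n': "4 * (m - Suc j) + 60 * (m + 1) * (size M\<^sub>0 + B - size (add_mset (f j) M)) + (52 * m + 11) + 2 \<le> n"
          unfolding n m4 by simp
        have "synced (add_mset (f j) M) T' (s'(16 := (s' 16)(0 := Suc j)))" using T' by (simp only: upd)
        then show "?Q (52 * m + 11) s'" using P' ag j' n' by blast
      qed simp
      moreover have "eval_test (Conj (Neg (Equal (Read 3 (Read 1 (var 16))) (Const 0)))
                 (Neg (Equal (Read 9 (Read a (var 16))) (Const 0)))) s1"
        using True tU fT j by simp
      ultimately have "halts ?body s1 (52 * m + 11) (?Q (52 * m + 11))"
        using fj j by (simp only: halts_Cond if_True halts_Seq_Write) (simp add: s2_def add.commute)
      then show ?thesis by blast
    qed
  qed
  then show ?thesis by (rule halts_mono) auto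
qed

text \<open>One pass suffices: if \<open>x\<close> stayed outside \<open>T\<close>, it would have
  been pushed once for each arc with tail \<open>x\<close>, making \<open>{x}\<close> tight and
  hence part of \<open>T\<close>.\<close>

lemma halts_flow_phase:
  assumes s: "synced {#} T\<^sub>0 s" and X: "\<And>v. s 3 v \<noteq> 0 \<longleftrightarrow> v \<in> X"
  shows "halts (phase_prog 1) s (4 * m + 60 * (m + 1) * flow G X Y + 2)
    (\<lambda>s'. agree ({5..16} \<union> {18, 19}) s s' \<and> (\<exists>M T. synced M T s' \<and> set_mset M \<subseteq> X \<and> X \<subseteq> T))"
proof -
  let ?P = "\<lambda>j M T. set_mset M \<subseteq> X \<and> (\<forall>x\<in>X - T. card {e. e < j \<and> tail G e = x} \<le> count M x)"
  have Suc_set: "{e. e < Suc j \<and> tail G e = x} =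
      (if tail G j = x then insert j {e. e < j \<and> tail G e = x} else {e. e < j \<and> tail G e = x})" for j x
    by (auto simp: less_Suc_eq)
  have "halts (phase_prog 1) s (4 * m + 60 * (m + 1) * flow G X Y + 2)
    (\<lambda>s'. agree ({5..16} \<union> {18, 19}) s s' \<and> (\<exists>M T. synced M T s' \<and> ?P m M T))"
  proof (rule halts_phase_prog[OF s, where U = X and f = "tail G" and P = ?P])
    fix j M T assume P: "?P j M T" and *: "tail G j \<notin> X \<or> tail G j \<in> T"
    then have "tail G j \<noteq> x" if "x \<in> X - T" for x using that by blast
    then show "?P (Suc j) M T" using P by (simp add: Suc_set)
  next
    fix j M T T' assume P: "?P j M T" and T: "greatest_tight M T" "tail G j \<in> X" "tail G j \<notin> T"
      "greatest_tight (add_mset (tail G j) M) T'"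
    have "T \<subseteq> T'" by (rule push_mono[OF T(1,3,4)])
    then have "X - T' \<subseteq> X - T" by blast
    then show "?P (Suc j) (add_mset (tail G j) M) T'"
      using P T(2) by (auto simp: Suc_set)
  next
    fix j :: nat and M T assume "?P j M T" "greatest_tight M T"
    then show "size M \<le> size {#} + flow G X Y" using size_pushes_le_flow[of M T] by simp
  qed (use X in simp_all)
  then show ?thesis
  proof (rule halts_mono)
    fix s' assume s': "agree ({5..16} \<union> {18, 19}) s s' \<and> (\<exists>M T. synced M T s' \<and> ?P m M T)"
    then obtain M T where M: "synced M T s'" "?P m M T" by blast
    have "x \<in> T" if x: "x \<in> X" for x
    proof (rule ccontr)
      assume "x \<notin> T"
      have "card (out_cut G {x}) \<le> card {e. e < m \<and> tail G e = x}"
        by (rule card_mono) (auto simp: out_cut_def)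
      also have "\<dots> \<le> count M x" using M(2) x \<open>x \<notin> T\<close> by blast
      finally have "residual M {x} \<le> 0" by (simp add: residual_def hits_singleton)
      moreover have "{x} \<subseteq> verts G - Y" using x X_verts XY_disjoint by auto
      ultimately have "{x} \<subseteq> T" using tight_subset_greatest[OF synced_greatest_tight[OF M(1)]] by blast
      then show False using \<open>x \<notin> T\<close> by simp
    qed
    then show "agree ({5..16} \<union> {18, 19}) s s' \<and> (\<exists>M T. synced M T s' \<and> set_mset M \<subseteq> X \<and> X \<subseteq> T)"
      using M s' by blast
  qed simp
qed

lemma halts_cover_phase:
  assumes s: "synced M\<^sub>0 T\<^sub>0 s" and U: "\<And>e. e < m \<Longrightarrow> s 3 (tail G e) \<noteq> 0 \<longleftrightarrow> tail G e \<in> T\<^sub>0"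
  shows "halts (phase_prog 2) s (4 * m + 60 * (m + 1) * size M\<^sub>0 + 2)
    (\<lambda>s'. agree ({5..16} \<union> {18, 19}) s s' \<and> (\<exists>M T. synced M T s' \<and> phase M\<^sub>0 T\<^sub>0 (arcs G) M T))"
proof -
  have gt: "greatest_tight M\<^sub>0 T\<^sub>0" using synced_greatest_tight[OF s] .
  have arcs: "arcs G = {..<m}" by (auto intro!: set_eqI)
  have "card (out_cut G T\<^sub>0) \<le> size M\<^sub>0"
    using gt hits_le_size[of M\<^sub>0 T\<^sub>0] by (simp add: greatest_tight_def residual_def)
  then have bound: "card (D \<inter> out_cut G T\<^sub>0) \<le> size M\<^sub>0" for D
    using card_mono[of "out_cut G T\<^sub>0" "D \<inter> out_cut G T\<^sub>0"] by simp
  show ?thesis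
    unfolding arcs
  proof (rule halts_phase_prog[OF s U, where f = "head G" and P = "\<lambda>j. phase M\<^sub>0 T\<^sub>0 {..<j}"])
    fix j M T assume "phase M\<^sub>0 T\<^sub>0 {..<j} M T"
    then show "size M \<le> size M\<^sub>0 + size M\<^sub>0" using bound[of "{..<j}"] by (simp add: phase_def)
  next
    show "phase M\<^sub>0 T\<^sub>0 {..<0} M\<^sub>0 T\<^sub>0" using phase_start[OF gt] by simp
  qed (auto simp: lessThan_Suc intro: phase_skip phase_push)
qed

lemma halts_update:
  assumes s: "synced M T s"
  shows "halts update_prog s (6 * m + 2) (\<lambda>s'. agree {3, 15} s s' \<and>
    (\<forall>v. s' 3 v \<noteq> 0 \<longleftrightarrow> s 3 v \<noteq> 0 \<or> v \<in> N \<inter> T))"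
proof -
  let ?I = "\<lambda>j s'. agree {3, 15} s s' \<and>
    (\<forall>v. s' 3 v \<noteq> 0 \<longleftrightarrow> s 3 v \<noteq> 0 \<or> (v \<in> T \<and> (\<exists>e<j. v = tail G e \<or> v = head G e)))"
  have "halts update_prog s ((4 + 2) * m + 2) (?I m)"
    unfolding update_prog_def
  proof (rule halts_for_arcs)
    show "?I 0 (s(15 := (s 15)(0 := 0)))" by simp
  next
    fix j s' assume "?I j s'"
    then have "s' 0 = s 0" by (simp add: agree_def)
    then show "s' 0 1 = m" using s by (simp add: synced_def input_kept_def)
  next
    fix j s1 assume I: "?I j s1" and j: "j < m" "s1 15 0 = j"
    have "s1 1 = s 1" "s1 2 = s 2" "s1 9 = s 9" using I by (simp_all add: agree_def)
    then have ends: "s1 1 j = tail G j" "s1 2 j = head G j"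
      "s1 9 (tail G j) = 0 \<longleftrightarrow> tail G j \<in> T" "s1 9 (head G j) = 0 \<longleftrightarrow> head G j \<in> T"
      using s j synced_visited_iff[OF s] by (simp_all add: synced_def input_kept_def)
    show "halts (Seq (mark_unvisited (Read 1 (var 15))) (mark_unvisited (Read 2 (var 15)))) s1 4
      (\<lambda>s'. s' 15 0 = j \<and> ?I (Suc j) (s'(15 := (s' 15)(0 := Suc j))))"
      using I ends j
      by (cases "tail G j \<in> T"; cases "head G j \<in> T") (auto simp: mark_unvisited_def less_Suc_eq)
  qed
  then show ?thesis by (rule halts_mono) (auto simp: N_def)
qed

subsection \<open>The whole program\<close>

text \<open>Isolated vertices outside \<open>X\<close> are never written, so only the part of
  \<open>T\<close> in \<open>N\<close> is stored besides \<open>X\<close>.\<close>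

definition marked :: "nat set \<Rightarrow> store \<Rightarrow> bool" where
  "marked T s \<longleftrightarrow> (\<forall>v. s 3 v \<noteq> 0 \<longleftrightarrow> v \<in> X \<union> N \<inter> T)"

lemma halts_copy:
  assumes s: "input_kept s"
  shows "halts copy_prog s (4 * m + 2) (\<lambda>s'. agree {5, 6, 15} s s' \<and>
    (\<forall>e<m. s' 5 e = tail G e \<and> s' 6 e = head G e))"
proof -
  let ?I = "\<lambda>j s'. agree {5, 6, 15} s s' \<and> (\<forall>e<j. s' 5 e = tail G e \<and> s' 6 e = head G e)"
  have kept: "input_kept s'" if "?I j s'" for j s'
    using that input_kept_agree[OF s, of "{5, 6, 15}" s'] by simp
  have "halts copy_prog s ((2 + 2) * m + 2) (?I m)"
    unfolding copy_prog_def
  proof (rule halts_for_arcs[where I = ?I])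
    show "?I 0 (s(15 := (s 15)(0 := 0)))" by (simp del: fun_upd_apply)
  next
    fix j s' assume "?I j s'"
    from kept[OF this] show "s' 0 1 = m" by (simp add: input_kept_def)
  next
    fix j s1 assume I: "?I j s1" and j: "j < m" "s1 15 0 = j"
    have "s1 1 j = tail G j" "s1 2 j = head G j"
      using kept[OF I] j by (simp_all add: input_kept_def)
    then show "halts (Seq (Write 5 (var 15) (Read 1 (var 15))) (Write 6 (var 15) (Read 2 (var 15)))) s1 2
      (\<lambda>s'. s' 15 0 = j \<and> ?I (Suc j) (s'(15 := (s' 15)(0 := Suc j))))"
      using I j by (simp add: less_Suc_eq)
  qed
  then show ?thesis by (rule halts_mono) simp_all
qed

lemma synced_agree: "synced M T s \<Longrightarrow> agree {3, 15, 17} s s' \<Longrightarrow> synced M T s'"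
  by (simp add: synced_def input_kept_def search_done_def agree_def)

lemma halts_init:
  assumes s: "input_kept s" and X: "\<And>v. s 3 v \<noteq> 0 \<longleftrightarrow> v \<in> X"
  shows "halts (Seq copy_prog (Seq search_prog (Seq (phase_prog 1) update_prog))) s
    (56 * m + 14 + 60 * (m + 1) * flow G X Y)
    (\<lambda>s'. agree ({3} \<union> {5..16} \<union> {18, 19}) s s' \<and>
      (\<exists>M T. synced M T s' \<and> covering k 0 M T \<and> marked T s'))" (is "halts _ _ _ ?Q")
proof (rule halts_Seq)
  let ?f = "60 * (m + 1) * flow G X Y"
  show "halts copy_prog s (4 * m + 2) (\<lambda>s1. halts (Seq search_prog (Seq (phase_prog 1) update_prog)) s1
      (52 * m + 12 + ?f) ?Q)"
    using halts_copy[OF s]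
  proof (rule halts_mono)
    fix s1 assume s1: "agree {5, 6, 15} s s1 \<and> (\<forall>e<m. s1 5 e = tail G e \<and> s1 6 e = head G e)"
    then have k1: "input_kept s1" using input_kept_agree[OF s, of "{5, 6, 15}" s1] by simp
    have o1: "orientation (s1 5) (s1 6)" using s1 by (simp add: orientation_def)
    have c1: "int (cut_size (arcs G) (s1 5) (s1 6) S) = residual {#} S" for S
    proof -
      have "{e \<in> arcs G. s1 5 e \<in> S \<and> s1 6 e \<notin> S} = {e \<in> arcs G. tail G e \<in> S \<and> head G e \<notin> S}"
        using s1 by auto
      then show ?thesis by (simp add: residual_def card_out_cut cut_size_def)
    qed
    have "halts search_prog s1 (42 * m + 8) (\<lambda>s2. halts (Seq (phase_prog 1) update_prog) s2 (10 * m + 4 + ?f) ?Q)"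
      using halts_search[OF k1 o1]
    proof (rule halts_mono)
      fix s2 assume s2: "agree {7, 8, 9, 10, 11, 12, 13, 14, 15} s1 s2 \<and> search_done s2"
      then have k2: "input_kept s2"
        using input_kept_agree[OF k1, of "{7, 8, 9, 10, 11, 12, 13, 14, 15}" s2] by simp
      have "s2 5 = s1 5" "s2 6 = s1 6" using s2 by (simp_all add: agree_def)
      then have y2: "synced {#} {v \<in> verts G - Y. v \<in> N \<longrightarrow> s2 9 v = 0} s2"
        using k2 s2 o1 c1 by (simp add: synced_def)
      have "s2 3 = s1 3" "s1 3 = s 3" using s1 s2 by (simp_all add: agree_def)
      then have x2: "s2 3 v \<noteq> 0 \<longleftrightarrow> v \<in> X" for v using X by simp
      have "halts (phase_prog 1) s2 (4 * m + ?f + 2) (\<lambda>s3. halts update_prog s3 (6 * m + 2) ?Q)"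
        using halts_flow_phase[OF y2 x2]
      proof (rule halts_mono)
        fix s3 assume s3: "agree ({5..16} \<union> {18, 19}) s2 s3 \<and>
          (\<exists>M T. synced M T s3 \<and> set_mset M \<subseteq> X \<and> X \<subseteq> T)"
        then obtain M T where M: "synced M T s3" "set_mset M \<subseteq> X" "X \<subseteq> T" by blast
        have cov: "covering k 0 M T" using covering_start[OF synced_greatest_tight[OF M(1)] M(2,3)] .
        have "s3 3 = s2 3" using s3 by (simp add: agree_def)
        then have x3: "s3 3 v \<noteq> 0 \<longleftrightarrow> v \<in> X" for v using x2 by simp
        show "halts update_prog s3 (6 * m + 2) ?Q"
          using halts_update[OF M(1)]
        proof (rule halts_mono)
          fix s' assume s': "agree {3, 15} s3 s' \<and> (\<forall>v. s' 3 v \<noteq> 0 \<longleftrightarrow> s3 3 v \<noteq> 0 \<or> v \<in> N \<inter> T)"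
          then have "marked T s'" unfolding marked_def using x3 by blast
          moreover have "synced M T s'" using synced_agree[OF M(1)] s' by (simp add: agree_def)
          moreover have "agree ({3} \<union> {5..16} \<union> {18, 19}) s s'"
            using s1 s2 s3 s' unfolding agree_def by auto
          ultimately show "?Q s'" using cov by blast
        qed simp
      qed simp
      then show "halts (Seq (phase_prog 1) update_prog) s2 (10 * m + 4 + ?f) ?Q"
        by (rule halts_Seq) simp
    qed simp
    then show "halts (Seq search_prog (Seq (phase_prog 1) update_prog)) s1 (52 * m + 12 + ?f) ?Q"
      by (rule halts_Seq) simp
  qed simp
qed simp

lemma halts_iteration:
  assumes s: "synced M\<^sub>0 T\<^sub>0 s" "covering k i M\<^sub>0 T\<^sub>0" "marked T\<^sub>0 s"
  shows "halts (Seq (phase_prog 2) (Seq update_prog (set_var 17 (Inc (var 17))))) s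
    (10 * m + 5 + 60 * (m + 1) * (flow G X Y * 2 ^ i))
    (\<lambda>s'. s' 0 = s 0 \<and> s' 17 0 = Suc (s 17 0) \<and>
      (\<exists>M T. synced M T s' \<and> covering k (Suc i) M T \<and> marked T s'))" (is "halts _ _ _ ?Q")
proof (rule halts_Seq)
  have U: "s 3 (tail G e) \<noteq> 0 \<longleftrightarrow> tail G e \<in> T\<^sub>0" if "e < m" for e
    using s(2,3) ends_in_N(1)[OF that] unfolding marked_def covering_def by blast
  have size: "size M\<^sub>0 \<le> flow G X Y * 2 ^ i" using s(2) by (simp add: covering_def)
  show "halts (phase_prog 2) s (4 * m + 60 * (m + 1) * (flow G X Y * 2 ^ i) + 2)
    (\<lambda>s1. halts (Seq update_prog (set_var 17 (Inc (var 17)))) s1 (6 * m + 3) ?Q)"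
    using halts_cover_phase[OF s(1) U]
  proof (rule halts_mono)
    show "4 * m + 60 * (m + 1) * size M\<^sub>0 + 2 \<le> 4 * m + 60 * (m + 1) * (flow G X Y * 2 ^ i) + 2"
      using mult_le_mono2[OF size, of "60 * (m + 1)"] by simp
  next
    fix s1 assume s1: "agree ({5..16} \<union> {18, 19}) s s1 \<and>
      (\<exists>M T. synced M T s1 \<and> phase M\<^sub>0 T\<^sub>0 (arcs G) M T)"
    then obtain M T where M: "synced M T s1" "phase M\<^sub>0 T\<^sub>0 (arcs G) M T" by blast
    have cov: "covering k (Suc i) M T" using covering_step[OF s(2) M(2)] .
    have TT: "T\<^sub>0 \<subseteq> T" using M(2) by (simp add: phase_def)
    have arr: "s1 0 = s 0" "s1 3 = s 3" "s1 17 = s 17" using s1 by (simp_all add: agree_def)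
    have "halts update_prog s1 (6 * m + 2) (\<lambda>s2. halts (set_var 17 (Inc (var 17))) s2 1 ?Q)"
      using halts_update[OF M(1)]
    proof (rule halts_mono)
      fix s2 assume s2: "agree {3, 15} s1 s2 \<and> (\<forall>v. s2 3 v \<noteq> 0 \<longleftrightarrow> s1 3 v \<noteq> 0 \<or> v \<in> N \<inter> T)"
      define s' where "s' = s2(17 := (s2 17)(0 := Suc (s2 17 0)))"
      have ag: "agree {3, 15} s1 s2" using s2 by blast
      then have "s2 0 = s1 0" "s2 17 = s1 17" by (simp_all add: agree_def)
      moreover have "synced M T s'"
        by (rule synced_agree[OF M(1)]) (use ag in \<open>auto simp: agree_def s'_def\<close>)
      moreover have "marked T s2" using s2 s(3) TT unfolding marked_def arr by blast
      then have "marked T s'" by (simp add: marked_def s'_def)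
      ultimately have "?Q s'" using cov arr by (auto simp: s'_def)
      moreover have "s2(17 := (s2 17)(0 := s2 17 0 + 1)) = s'" by (simp add: s'_def)
      ultimately show "halts (set_var 17 (Inc (var 17))) s2 1 ?Q"
        by (simp only: halts_Write eval_exp.simps) simp
    qed simp
    then show "halts (Seq update_prog (set_var 17 (Inc (var 17)))) s1 (6 * m + 3) ?Q"
      by (rule halts_Seq) simp
  qed
qed simp

lemma halts_cover:
  assumes s: "input_kept s" "s 0 2 = k" "s 17 0 = 0" and X: "\<And>v. s 3 v \<noteq> 0 \<longleftrightarrow> v \<in> X"
  shows "halts cover_prog s (60 * ((m + 1) * (1 + k + flow G X Y * 2 ^ k)))
    (\<lambda>s'. \<exists>M T. covering k k M T \<and> marked T s')"
proof -
  let ?l = "flow G X Y" and ?b = "Less (var 17) (Read 0 (Const 2))"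
  let ?p = "Seq (phase_prog 2) (Seq update_prog (set_var 17 (Inc (var 17))))"
  \<comment> \<open>The phase after \<open>i\<close> phases costs at most
    \<open>10 * (m + 1)\<close> plus \<open>60 * (m + 1) * (?l * 2 ^ i)\<close>; summing the powers
    from \<open>i\<close> to \<open>k - 1\<close> gives \<open>2 ^ k - 2 ^ i\<close>.\<close>
  let ?n = "\<lambda>i. (k - i) * (10 * (m + 1)) + 60 * (m + 1) * (?l * (2 ^ k - 2 ^ i))"
  let ?I = "\<lambda>n s. s 0 2 = k \<and> (\<exists>i M T. i \<le> k \<and> s 17 0 = i \<and> n = ?n i \<and>
    synced M T s \<and> covering k i M T \<and> marked T s)"
  have loop: "halts (Loop ?b ?p) s (?n 0 + 1) (\<lambda>s'. (\<exists>n'. ?I n' s') \<and> \<not> eval_test ?b s')"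
    if "?I (?n 0) s" for s
  proof (rule halts_Loop[of ?I, OF that])
    fix n s assume I: "?I n s" and test: "eval_test ?b s"
    then obtain i M T where i: "i \<le> k" "s 17 0 = i" "n = ?n i"
      and M: "synced M T s" "covering k i M T" "marked T s" by blast
    have "i < k" using test I i by simp
    let ?c = "10 * m + 5 + 60 * (m + 1) * (?l * 2 ^ i)"
    have "(2::nat) ^ Suc i \<le> 2 ^ k" using \<open>i < k\<close> by (intro power_increasing) auto
    then have "?l * 2 ^ i + ?l * (2 ^ k - 2 ^ Suc i) = ?l * (2 ^ k - 2 ^ i)"
      by (simp add: distrib_left[symmetric])
    then have "60 * (m + 1) * (?l * (2 ^ k - 2 ^ i)) =
        60 * (m + 1) * (?l * 2 ^ i) + 60 * (m + 1) * (?l * (2 ^ k - 2 ^ Suc i))"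
      by (metis distrib_left)
    moreover have "(k - i) * (10 * (m + 1)) = (k - Suc i) * (10 * (m + 1)) + 10 * m + 10"
    proof -
      have "k - i = Suc (k - Suc i)" using \<open>i < k\<close> by simp
      then show ?thesis by (simp only: mult_Suc) simp
    qed
    ultimately have n: "?n (Suc i) + ?c + 1 \<le> n" unfolding i(3) by simp
    from halts_iteration[OF M]
    have "halts ?p s ?c (\<lambda>s'. \<exists>n'. ?I n' s' \<and> n' + ?c + 1 \<le> n)"
    proof (rule halts_mono)
      fix s' assume s': "s' 0 = s 0 \<and> s' 17 0 = Suc (s 17 0) \<and>
        (\<exists>M T. synced M T s' \<and> covering k (Suc i) M T \<and> marked T s')"
      then have "?I (?n (Suc i)) s'" using i I \<open>i < k\<close> by auto
      then show "\<exists>n'. ?I n' s' \<and> n' + ?c + 1 \<le> n" using n by blast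
    qed simp
    then show "\<exists>c. halts ?p s c (\<lambda>s'. \<exists>n'. ?I n' s' \<and> n' + c + 1 \<le> n)" by blast
  qed
  let ?i = "Seq copy_prog (Seq search_prog (Seq (phase_prog 1) update_prog))"
  have "halts (Seq ?i (Loop ?b ?p)) s (60 * ((m + 1) * (1 + k + ?l * 2 ^ k)))
    (\<lambda>s'. \<exists>M T. covering k k M T \<and> marked T s')" (is "halts _ _ ?B ?Q")
  proof (rule halts_Seq)
    show "halts ?i s (56 * m + 14 + 60 * (m + 1) * ?l) (\<lambda>s'. halts (Loop ?b ?p) s' (?n 0 + 1) ?Q)"
      using halts_init[OF s(1) X, where k = k]
    proof (rule halts_mono)
      fix s1 assume s1: "agree ({3} \<union> {5..16} \<union> {18, 19}) s s1 \<and>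
        (\<exists>M T. synced M T s1 \<and> covering k 0 M T \<and> marked T s1)"
      then have "s1 0 = s 0" "s1 17 = s 17" by (simp_all add: agree_def)
      then have "?I (?n 0) s1" using s1 s by auto
      from loop[OF this] show "halts (Loop ?b ?p) s1 (?n 0 + 1) ?Q"
      proof (rule halts_mono)
        fix s' assume s': "(\<exists>n'. ?I n' s') \<and> \<not> eval_test ?b s'"
        then obtain i M T where i: "i \<le> k" "s' 17 0 = i" "covering k i M T" "marked T s'" by blast
        then have "i = k" using s' by simp
        then show "?Q s'" using i by blast
      qed simp
    qed simp
    have "?l + ?l * (2 ^ k - 2 ^ 0) = ?l * 2 ^ k" by (simp add: diff_mult_distrib2)
    then have "60 * (m + 1) * ?l + 60 * (m + 1) * (?l * (2 ^ k - 2 ^ 0)) = 60 * (m + 1) * (?l * 2 ^ k)"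
      by (metis distrib_left)
    moreover have "60 * ((m + 1) * (1 + k + ?l * 2 ^ k)) = 60 * (m + 1) + 60 * (m + 1) * k + 60 * (m + 1) * (?l * 2 ^ k)"
      by (simp add: algebra_simps)
    moreover have "(k - 0) * (10 * (m + 1)) \<le> 60 * (m + 1) * k" by simp
    moreover have "56 * m + 15 \<le> 60 * (m + 1)" by simp
    ultimately show "56 * m + 14 + 60 * (m + 1) * ?l + (?n 0 + 1) \<le> ?B" by linarith
  qed
  then show ?thesis by (simp only: cover_prog_def)
qed

lemma out_reachable_marked:
  assumes "out_reachable_cut G X Y S"
  shows "S \<subseteq> X \<union> N"
proof
  fix v assume "v \<in> S"
  let ?H = "delete_arcs G (out_cut G S)"
  have H: "verts ?H = verts G" "arcs ?H = arcs G - out_cut G S" "tail ?H = tail G" "head ?H = head G"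
    by (simp_all add: delete_arcs_def)
  interpret H: wf_digraph ?H
    by unfold_locales (auto simp: H)
  obtain x where "x \<in> X" "x \<rightarrow>\<^sup>*\<^bsub>?H\<^esub> v" using assms \<open>v \<in> S\<close> by (auto simp: out_reachable_cut_def)
  from this(2) this(1) show "v \<in> X \<union> N"
  proof (induction rule: H.reachable_induct)
    case (step u w)
    then obtain e where "e \<in> arcs G" "head G e = w"
      by (auto simp: arcs_ends_def arc_to_ends_def H)
    then show ?case by (auto simp: N_def)
  qed simp
qed

text \<open>Omitting isolated vertices from \<open>T\<close> changes no leaving arc, and an
  out-reachable cut contains such vertices only if they belong to \<open>X\<close>.\<close>

lemma marked_result:
  assumes cov: "covering k k M T" and s: "marked T s"
  shows "is_XY_cut G X Y (output_set G s)" "card (out_cut G (output_set G s)) \<le> flow G X Y * 2 ^ k"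
    "covers_important_cuts G X Y (flow G X Y + k) (output_set G s)"
proof -
  note res = covering_result[OF cov]
  have XT: "X \<subseteq> T" using cov by (simp add: covering_def)
  have S: "output_set G s = X \<union> N \<inter> T"
    using s X_verts N_verts unfolding output_set_def marked_def by blast
  show "is_XY_cut G X Y (output_set G s)"
    using res(1) XT unfolding S is_XY_cut_def by blast
  have "out_cut G (output_set G s) = out_cut G T"
    unfolding S out_cut_def using XT by (auto simp: N_def)
  then show "card (out_cut G (output_set G s)) \<le> flow G X Y * 2 ^ k" using res(2) by simp
  show "covers_important_cuts G X Y (flow G X Y + k) (output_set G s)"
    unfolding covers_important_cuts_def
  proof (intro allI impI)
    fix S' assume S': "important_cut G X Y S' \<and> card (out_cut G S') \<le> flow G X Y + k"
    then have "S' \<subseteq> T" using res(3) by (simp add: covers_important_cuts_def)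
    moreover have "S' \<subseteq> X \<union> N"
      using S' out_reachable_marked by (simp add: important_cut_def)
    ultimately show "S' \<subseteq> output_set G s" unfolding S by blast
  qed
qed

end

section \<open>Comparison with the required time bound and conclusion\<close>

lemma time_bound_ge: "(m + 1) * (1 + k + l * 2 ^ k) \<le> 3 * time_bound l k m"
proof -
  let ?W = "max 1 l * max 1 k * 2 ^ k :: nat"
  have "1 \<le> ?W" by simp
  moreover have "k \<le> ?W"
  proof -
    have "k \<le> max 1 k" by simp
    also have "max 1 k = 1 * max 1 k * 1" by simp
    also have "\<dots> \<le> ?W" by (intro mult_mono) auto
    finally show ?thesis .
  qed
  moreover have "l * 2 ^ k \<le> ?W"
  proof -
    have "l * 2 ^ k = l * 1 * 2 ^ k" by simp
    also have "\<dots> \<le> ?W" by (intro mult_mono) auto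
    finally show ?thesis .
  qed
  ultimately have "1 + k + l * 2 ^ k \<le> 3 * ?W" by linarith
  then have "(m + 1) * (1 + k + l * 2 ^ k) \<le> (m + 1) * (3 * ?W)" by (rule mult_le_mono2)
  also have "\<dots> = 3 * (?W * m + ?W)" by (simp add: algebra_simps)
  \<comment> \<open>The square of \<open>?W\<close> is the second summand of
    \<open>time_bound\<close>, so it absorbs the cost that is independent of
    \<open>m\<close>.\<close>
  also have "\<dots> \<le> 3 * (?W * m + ?W * ?W)"
    using mult_le_mono1[OF \<open>1 \<le> ?W\<close>, of ?W] by simp
  also have "?W * m + ?W * ?W = time_bound l k m"
  proof -
    have "(4::nat) ^ k = 2 ^ k * 2 ^ k" by (simp flip: power_mult_distrib)
    then show ?thesis by (simp add: time_bound_def power2_eq_square ac_simps)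
  qed
  finally show ?thesis .
qed

theorem theorem6p1:
  shows "(\<forall>(G :: ('a, 'b) pre_digraph) X Y l k.
            fin_digraph G \<and> X \<subseteq> verts G \<and> Y \<subseteq> verts G \<and> X \<inter> Y = {} \<and> flow G X Y = l \<longrightarrow>
            (\<exists>S. is_XY_cut G X Y S \<and> card (out_cut G S) \<le> l * 2 ^ k \<and>
                 covers_important_cuts G X Y (l + k) S)) \<and>
         (\<exists>p C. \<forall>(G :: (nat, nat) pre_digraph) X Y l k m.
            fin_digraph G \<and> numbered G \<and> card (arcs G) = m \<and>
            X \<subseteq> verts G \<and> Y \<subseteq> verts G \<and> X \<inter> Y = {} \<and> flow G X Y = l \<longrightarrow>
            (\<exists>t s S. exec p (input_store G X Y k) t s \<and> t \<le> C * time_bound l k m \<and>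
                 S = output_set G s \<and>
                 is_XY_cut G X Y S \<and> card (out_cut G S) \<le> l * 2 ^ k \<and>
                 covers_important_cuts G X Y (l + k) S))"
proof (rule conjI)
  show "\<forall>(G :: ('a, 'b) pre_digraph) X Y l k.
            fin_digraph G \<and> X \<subseteq> verts G \<and> Y \<subseteq> verts G \<and> X \<inter> Y = {} \<and> flow G X Y = l \<longrightarrow>
            (\<exists>S. is_XY_cut G X Y S \<and> card (out_cut G S) \<le> l * 2 ^ k \<and>
                 covers_important_cuts G X Y (l + k) S)"
  proof (intro allI impI)
    fix G :: "('a, 'b) pre_digraph" and X Y l k
    assume *: "fin_digraph G \<and> X \<subseteq> verts G \<and> Y \<subseteq> verts G \<and> X \<inter> Y = {} \<and> flow G X Y = l"
    then interpret fin_digraph G by simp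
    interpret terminal_digraph G X Y using * by unfold_locales auto
    obtain M T where "covering k k M T" using covering_exists by blast
    from covering_result[OF this] show "\<exists>S. is_XY_cut G X Y S \<and> card (out_cut G S) \<le> l * 2 ^ k \<and>
                 covers_important_cuts G X Y (l + k) S" using * by blast
  qed
next
  \<comment> \<open>The constant 180 is 60 from \<open>halts_cover\<close> times 3 from
    \<open>time_bound_ge\<close>.\<close>
  have "\<exists>t s S. exec cover_prog (input_store G X Y k) t s \<and> t \<le> 180 * time_bound l k m \<and>
                 S = output_set G s \<and>
                 is_XY_cut G X Y S \<and> card (out_cut G S) \<le> l * 2 ^ k \<and>
                 covers_important_cuts G X Y (l + k) S"
    if *: "fin_digraph G \<and> numbered G \<and> card (arcs G) = m \<and>
            X \<subseteq> verts G \<and> Y \<subseteq> verts G \<and> X \<inter> Y = {} \<and> flow G X Y = l"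
    for G :: "(nat, nat) pre_digraph" and X Y l k m
  proof -
    interpret fin_digraph G using * by simp
    interpret I: numbered_instance G X Y using * by unfold_locales auto
    let ?s = "input_store G X Y k"
    have m: "I.m = m" using * by (simp add: I.m_def)
    have "I.input_kept ?s"
      unfolding I.input_kept_def using * by (simp add: input_store_def I.m_def)
    then have "halts cover_prog ?s (60 * ((I.m + 1) * (1 + k + flow G X Y * 2 ^ k)))
      (\<lambda>s'. \<exists>M T. I.covering k k M T \<and> I.marked T s')"
      by (rule I.halts_cover) (simp_all add: input_store_def)
    then obtain t s M T where t: "exec cover_prog ?s t s" "t \<le> 60 * ((m + 1) * (1 + k + l * 2 ^ k))"
      and c: "I.covering k k M T" "I.marked T s"
      unfolding halts_def using * m by auto
    have "t \<le> 180 * time_bound l k m" using t(2) time_bound_ge[of m k l] by linarith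
    then show ?thesis using t(1) I.marked_result[OF c] * by blast
  qed
  then show "\<exists>p C. \<forall>(G :: (nat, nat) pre_digraph) X Y l k m.
            fin_digraph G \<and> numbered G \<and> card (arcs G) = m \<and>
            X \<subseteq> verts G \<and> Y \<subseteq> verts G \<and> X \<inter> Y = {} \<and> flow G X Y = l \<longrightarrow>
            (\<exists>t s S. exec p (input_store G X Y k) t s \<and> t \<le> C * time_bound l k m \<and>
                 S = output_set G s \<and>
                 is_XY_cut G X Y S \<and> card (out_cut G S) \<le> l * 2 ^ k \<and>
                 covers_important_cuts G X Y (l + k) S)"
    by blast
qed

end
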